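(* Let $K$ be a totally real field (an algebraic extension of $\mathbb{Q}$ all of whose elements are totally real). Then a positive definite quadratic lattice $(\mathcal L,Q)$ over $K$ of rank $n\geq 2$ represents at most $2n-2$ classes of $\mathcal{O}_K^{\times,+}/\mathcal{O}_K^{\times 2}$. Furthermore, if $\gamma_K K^{\times 2}\cap\mathcal{O}_K^{\times,+}=\emptyset$, then $(\mathcal L,Q)$ represents at most $n$ classes of $\mathcal{O}_K^{\times,+}/\mathcal{O}_K^{\times 2}$.
   Context: $\mathcal{O}_K$ is the ring of algebraic integers in $K$; $\mathcal{O}_K^{\times 2}$ the set of squares of units; $\mathcal{O}_K^{\times,+}$ the set of totally positive units (units $\varepsilon$ with $\sigma(\varepsilon)>0$ for all embeddings $\sigma:K\hookrightarrow\mathbb{R}$); $K^{\times 2}$ the set of nonzero squares in $K$. A quadratic lattice over $K$ is a pair $(\mathcal L,Q)$ with $\mathcal L$ a torsion-free finitely generated $\mathcal{O}_K$-module and $Q:\mathcal L\to\mathcal{O}_K$ a map with $Q(av)=a^2Q(v)$ ($a\in\mathcal{O}_K$, $v\in\mathcal L$) such that $B_Q(v,w)=\frac12(Q(v+w)-Q(v)-Q(w))$ is bilinear; its rank is $\dim_K(\mathcal L\otimes_{\mathcal{O}_K}K)$. It is positive definite if $Q(v)$ is totally positive for all $v\in\mathcal L\setminus\{0\}$. The lattice represents $d$ if $d=Q(v)$ for some $v\in\mathcal L$, and it represents a class of $\mathcal{O}_K^{\times,+}/\mathcal{O}_K^{\times 2}$ if it represents at least one element of that class. For $a\in\mathbb{Q}$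 let $g(a)=2\cos(2\pi a)$. Define $\gamma_K=g(1/2^m)^2$ if $m>0$ is such that $g(1/2^m)^2\in K$ but $g(1/2^m)\notin K$ (such $m$ is unique if it exists), and $\gamma_K=-1$ if no such $m$ exists. *)

theory Defs
  imports
    Complex_Main
    "HOL-Algebra.Algebraic_Closure_Type"
    "HOL-Algebra.Free_Abelian_Groups"
    "Jordan_Normal_Form.Missing_VectorSpace"
begin

definition real_subring :: "real set \<Rightarrow> real ring" where
  "real_subring S = (ring_of_type_algebra :: real ring)\<lparr>carrier := S\<rparr>"

definition totally_real :: "real \<Rightarrow> bool" where
  "totally_real x \<longleftrightarrow> algebraic x \<and>
     (\<forall>p :: rat poly. irreducible p \<and> poly (map_poly of_rat p) x = 0 \<longrightarrow>
        (\<forall>z :: complex. poly (map_poly of_rat p) z = 0 \<longrightarrow> z \<in> \<real>))"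

text \<open>A totally real field is given together with its inclusion into the real numbers, so that it
  makes sense to ask whether \<open>2 cos (2 \<pi> a)\<close> belongs to it. Its degree may be infinite.\<close>

definition totally_real_field :: "real set \<Rightarrow> bool" where
  "totally_real_field K \<longleftrightarrow>
     subfield K (ring_of_type_algebra :: real ring) \<and> (\<forall>x\<in>K. totally_real x)"

definition real_embeddings :: "real set \<Rightarrow> (real \<Rightarrow> real) set" where
  "real_embeddings K = ring_hom (real_subring K) ring_of_type_algebra"

definition totally_positive :: "real set \<Rightarrow> real \<Rightarrow> bool" where
  "totally_positive K x \<longleftrightarrow> (\<forall>\<sigma>\<in>real_embeddings K. \<sigma> x > 0)"

definition integers_of :: "real set \<Rightarrow> real ring" where
  "integers_of K = real_subring {x \<in> K. algebraic_int x}"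

definition unit_squares :: "real set \<Rightarrow> real set" where
  "unit_squares K = {u ^ 2 |u. u \<in> Units (integers_of K)}"

definition totally_positive_units :: "real set \<Rightarrow> real set" where
  "totally_positive_units K = {u \<in> Units (integers_of K). totally_positive K u}"

definition unit_class_group :: "real set \<Rightarrow> real set monoid" where
  "unit_class_group K =
     (units_of (integers_of K))\<lparr>carrier := totally_positive_units K\<rparr> Mod unit_squares K"

text \<open>The base change of an \<open>\<O>\<^sub>K\<close>-module \<open>L\<close> to \<open>K\<close>: the free abelian group on the set
  \<open>L \<times> K\<close>, whose generator \<open>(v, c)\<close> stands for \<open>v \<otimes> c\<close>, modulo the bilinearity and balancing
  relations. A scalar \<open>d\<close> in \<open>K\<close> acts by \<open>d (v \<otimes> c) = v \<otimes> d c\<close>.\<close>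

definition tensor_relations ::
    "real set \<Rightarrow> (real, 'v, 'm) module_scheme \<Rightarrow> (('v \<times> real) \<Rightarrow>\<^sub>0 int) set" where
  "tensor_relations K L =
     {frag_of (v \<oplus>\<^bsub>L\<^esub> w, c) - frag_of (v, c) - frag_of (w, c) |v w c.
        v \<in> carrier L \<and> w \<in> carrier L \<and> c \<in> K} \<union>
     {frag_of (v, c + d) - frag_of (v, c) - frag_of (v, d) |v c d.
        v \<in> carrier L \<and> c \<in> K \<and> d \<in> K} \<union>
     {frag_of (a \<odot>\<^bsub>L\<^esub> v, c) - frag_of (v, a * c) |a v c.
        a \<in> carrier (integers_of K) \<and> v \<in> carrier L \<and> c \<in> K}"

definition tensor_kernel ::
    "real set \<Rightarrow> (real, 'v, 'm) module_scheme \<Rightarrow> (('v \<times> real) \<Rightarrow>\<^sub>0 int) set" where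
  "tensor_kernel K L = generate (free_Abelian_group (carrier L \<times> K)) (tensor_relations K L)"

definition tensor_field ::
    "real set \<Rightarrow> (real, 'v, 'm) module_scheme \<Rightarrow> (real, (('v \<times> real) \<Rightarrow>\<^sub>0 int) set) module" where
  "tensor_field K L =
     (let F = free_Abelian_group (carrier L \<times> K); N = tensor_kernel K L in
      \<lparr>carrier = rcosets\<^bsub>F\<^esub> N, monoid.mult = undefined, one = undefined,
       ring.zero = N, add = set_mult F,
       module.smult = (\<lambda>d C. \<Union>x\<in>C. N #>\<^bsub>F\<^esub> frag_extend (\<lambda>(v, c). frag_of (v, d * c)) x)\<rparr>)"

definition lattice_rank :: "real set \<Rightarrow> (real, 'v, 'm) module_scheme \<Rightarrow> nat" where
  "lattice_rank K L = vectorspace.dim (real_subring K) (tensor_field K L)"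

definition polar_form ::
    "(real, 'v, 'm) module_scheme \<Rightarrow> ('v \<Rightarrow> real) \<Rightarrow> 'v \<Rightarrow> 'v \<Rightarrow> real" where
  "polar_form L Q v w = (Q (v \<oplus>\<^bsub>L\<^esub> w) - Q v - Q w) / 2"

definition bilinear_form ::
    "real set \<Rightarrow> (real, 'v, 'm) module_scheme \<Rightarrow> ('v \<Rightarrow> 'v \<Rightarrow> real) \<Rightarrow> bool" where
  "bilinear_form K L B \<longleftrightarrow>
     (\<forall>u\<in>carrier L. \<forall>v\<in>carrier L. \<forall>w\<in>carrier L.
        B (u \<oplus>\<^bsub>L\<^esub> v) w = B u w + B v w \<and> B w (u \<oplus>\<^bsub>L\<^esub> v) = B w u + B w v) \<and>
     (\<forall>a\<in>carrier (integers_of K). \<forall>v\<in>carrier L. \<forall>w\<in>carrier L.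
        B (a \<odot>\<^bsub>L\<^esub> v) w = a * B v w \<and> B v (a \<odot>\<^bsub>L\<^esub> w) = a * B v w)"

definition quadratic_lattice ::
    "real set \<Rightarrow> (real, 'v, 'm) module_scheme \<Rightarrow> ('v \<Rightarrow> real) \<Rightarrow> bool" where
  "quadratic_lattice K L Q \<longleftrightarrow>
     module (integers_of K) L \<and>
     (\<exists>A. finite A \<and> A \<subseteq> carrier L \<and> module.span (integers_of K) L A = carrier L) \<and>
     (\<forall>a\<in>carrier (integers_of K). \<forall>v\<in>carrier L.
        a \<odot>\<^bsub>L\<^esub> v = \<zero>\<^bsub>L\<^esub> \<longrightarrow> a = 0 \<or> v = \<zero>\<^bsub>L\<^esub>) \<and>
     Q \<in> carrier L \<rightarrow> carrier (integers_of K) \<and>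
     (\<forall>a\<in>carrier (integers_of K). \<forall>v\<in>carrier L. Q (a \<odot>\<^bsub>L\<^esub> v) = a ^ 2 * Q v) \<and>
     bilinear_form K L (polar_form L Q)"

definition positive_definite ::
    "real set \<Rightarrow> (real, 'v, 'm) module_scheme \<Rightarrow> ('v \<Rightarrow> real) \<Rightarrow> bool" where
  "positive_definite K L Q \<longleftrightarrow> (\<forall>v\<in>carrier L - {\<zero>\<^bsub>L\<^esub>}. totally_positive K (Q v))"

definition represents :: "(real, 'v, 'm) module_scheme \<Rightarrow> ('v \<Rightarrow> real) \<Rightarrow> real \<Rightarrow> bool" where
  "represents L Q d \<longleftrightarrow> (\<exists>v\<in>carrier L. d = Q v)"

definition represented_classes ::
    "real set \<Rightarrow> (real, 'v, 'm) module_scheme \<Rightarrow> ('v \<Rightarrow> real) \<Rightarrow> real set set" where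
  "represented_classes K L Q = {C \<in> carrier (unit_class_group K). \<exists>d\<in>C. represents L Q d}"

definition gcos :: "rat \<Rightarrow> real" where
  "gcos a = 2 * cos (2 * pi * of_rat a)"

definition gamma_index :: "real set \<Rightarrow> nat \<Rightarrow> bool" where
  "gamma_index K m \<longleftrightarrow> m > 0 \<and> (gcos (1 / 2 ^ m))\<^sup>2 \<in> K \<and> gcos (1 / 2 ^ m) \<notin> K"

definition gamma_of :: "real set \<Rightarrow> real" where
  "gamma_of K =
     (if \<exists>m. gamma_index K m then (gcos (1 / 2 ^ (THE m. gamma_index K m)))\<^sup>2 else - 1)"

lemma field_real_subring:
  assumes "totally_real_field K"
  shows "field (real_subring K)"
  using assms unfolding totally_real_field_def real_subring_def
  by (metis ring.subfield_iff(2) ring_from_type_algebra)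

lemma tensor_relations_subset:
  assumes K: "totally_real_field K" and L: "module (integers_of K) L"
  shows "tensor_relations K L \<subseteq> carrier (free_Abelian_group (carrier L \<times> K))"
proof -
  interpret L: module "integers_of K" L by (rule L)
  interpret K: field "real_subring K" by (rule field_real_subring[OF K])
  have add: "c + d \<in> K" and mult: "c * d \<in> K" if "c \<in> K" "d \<in> K" for c d
    using K.add.m_closed[of c d] K.m_closed[of c d] that
    by (auto simp: real_subring_def ring_of_type_algebra_def)
  have int: "a \<in> K" if "a \<in> carrier (integers_of K)" for a
    using that by (auto simp: integers_of_def real_subring_def)
  have diff: "x - y \<in> carrier (free_Abelian_group S)"
    if "x \<in> carrier (free_Abelian_group S)" "y \<in> carrier (free_Abelian_group S)"
    for x y :: "('a \<times> real) \<Rightarrow>\<^sub>0 int" and S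
    using that keys_diff[of x y] by (auto simp: free_Abelian_group_def)
  have gen: "frag_of (v, c) \<in> carrier (free_Abelian_group (carrier L \<times> K))"
    if "v \<in> carrier L" "c \<in> K" for v c
    using that by (auto simp: free_Abelian_group_def)
  show ?thesis
    unfolding tensor_relations_def
    by (auto intro!: diff gen add mult dest: int)
qed

lemma vectorspace_tensor_field:
  assumes K: "totally_real_field K" and L: "module (integers_of K) L"
  shows "vectorspace (real_subring K) (tensor_field K L)"
proof -
  interpret L: module "integers_of K" L by (rule L)
  interpret K: field "real_subring K" by (rule field_real_subring[OF K])
  define F where "F = free_Abelian_group (carrier L \<times> K)"
  define N where "N = tensor_kernel K L"
  define s where "s d = frag_extend (\<lambda>(v :: 'a, c). frag_of (v, d * c))" for d :: real
  interpret F: comm_group F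
    unfolding F_def by (rule abelian_free_Abelian_group)
  have rels: "tensor_relations K L \<subseteq> carrier F"
    unfolding F_def by (rule tensor_relations_subset[OF K L])
  have Ngen: "N = generate F (tensor_relations K L)"
    by (simp add: N_def F_def tensor_kernel_def)
  have subN: "subgroup N F"
    unfolding Ngen by (rule F.generate_is_subgroup[OF rels])
  then interpret N: normal N F
    by (simp add: F.subgroup_imp_normal)
  have Fadd: "x \<otimes>\<^bsub>F\<^esub> y = x + y" and F0: "\<one>\<^bsub>F\<^esub> = 0" for x y
    by (simp_all add: F_def)
  have Finv: "inv\<^bsub>F\<^esub> x = - x" if "x \<in> carrier F" for x
    using that by (simp add: F_def)
  have Nadd: "x + y \<in> N" if "x \<in> N" "y \<in> N" for x y
    using N.m_closed[OF that] by (simp add: Fadd)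
  have N0: "0 \<in> N" using N.one_closed by (simp add: F0)
  have Nneg: "- x \<in> N" if "x \<in> N" for x
    using N.m_inv_closed[OF that] Finv[OF N.mem_carrier[OF that]] by simp
  have Kadd: "c + d \<in> K" and Kmult: "c * d \<in> K" if "c \<in> K" "d \<in> K" for c d
    using K.add.m_closed[of c d] K.m_closed[of c d] that
    by (auto simp: real_subring_def ring_of_type_algebra_def)
  have K1: "1 \<in> K" using K.one_closed by (simp add: real_subring_def ring_of_type_algebra_def)
  have s_of: "s d (frag_of (v, c)) = frag_of (v, d * c)" for d v c
    by (simp add: s_def)
  have s_add: "s d (x + y) = s d x + s d y" and s_diff: "s d (x - y) = s d x - s d y"
    and s_neg: "s d (- x) = - s d x" and s_0: "s d 0 = 0" for d x y
    by (simp_all add: s_def frag_extend_add frag_extend_diff frag_extend_minus)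
  have s_F: "s d x \<in> carrier F" if "x \<in> carrier F" "d \<in> K" for d x
    using that unfolding F_def s_def free_Abelian_group_def
    by (force dest!: subsetD[OF keys_frag_extend] intro!: Kmult)
  have rel_N: "x \<in> N" if "x \<in> tensor_relations K L" for x
    unfolding Ngen using that by (rule generate.incl)
  have s_rel: "s d x \<in> tensor_relations K L" if x: "x \<in> tensor_relations K L" and d: "d \<in> K" for d x
  proof -
    consider (a) v w c where "x = frag_of (v \<oplus>\<^bsub>L\<^esub> w, c) - frag_of (v, c) - frag_of (w, c)"
          "v \<in> carrier L" "w \<in> carrier L" "c \<in> K"
      | (b) v c e where "x = frag_of (v, c + e) - frag_of (v, c) - frag_of (v, e)"
          "v \<in> carrier L" "c \<in> K" "e \<in> K"
      | (c) a v c where "x = frag_of (a \<odot>\<^bsub>L\<^esub> v, c) - frag_of (v, a * c)"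
          "a \<in> carrier (integers_of K)" "v \<in> carrier L" "c \<in> K"
      using x unfolding tensor_relations_def by blast
    then show ?thesis
    proof cases
      case a
      then have "s d x = frag_of (v \<oplus>\<^bsub>L\<^esub> w, d * c) - frag_of (v, d * c) - frag_of (w, d * c)"
        by (simp add: s_diff s_of)
      then show ?thesis using a d Kmult unfolding tensor_relations_def by blast
    next
      case b
      then have "s d x = frag_of (v, d * c + d * e) - frag_of (v, d * c) - frag_of (v, d * e)"
        by (simp add: s_diff s_of distrib_left)
      then show ?thesis using b d Kmult unfolding tensor_relations_def by blast
    next
      case c
      then have "s d x = frag_of (a \<odot>\<^bsub>L\<^esub> v, d * c) - frag_of (v, a * (d * c))"
        by (simp add: s_diff s_of mult.left_commute)
      then show ?thesis using c d Kmult unfolding tensor_relations_def by blast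
    qed
  qed
  have s_N: "s d x \<in> N" if "x \<in> N" "d \<in> K" for d x
    using that(1) unfolding Ngen
  proof (induction rule: generate.induct)
    case one
    then show ?case using N0 by (simp add: F0 s_0 Ngen)
  next
    case (incl h)
    then show ?case using s_rel that(2) by (auto intro: generate.incl)
  next
    case (inv h)
    then have "s d (inv\<^bsub>F\<^esub> h) = inv\<^bsub>F\<^esub> (s d h)"
      using rels s_F that(2) by (simp add: Finv s_neg subset_iff)
    then show ?case using inv s_rel that(2) by (auto intro: generate.inv)
  next
    case (eng h1 h2)
    then show ?case using Nadd by (simp add: Fadd s_add Ngen)
  qed
  have coset_eq: "N #>\<^bsub>F\<^esub> x = N #>\<^bsub>F\<^esub> y" if "x - y \<in> N" "x \<in> carrier F" "y \<in> carrier F" for x y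
  proof -
    have "x = (x - y) \<otimes>\<^bsub>F\<^esub> y" by (simp add: Fadd)
    then have "x \<in> N #>\<^bsub>F\<^esub> y" using that(1) unfolding r_coset_def by blast
    then show ?thesis using F.repr_independence[OF _ that(3) subN] by simp
  qed
  let ?T = "tensor_field K L"
  have T_carrier: "carrier ?T = rcosets\<^bsub>F\<^esub> N" and T_zero: "\<zero>\<^bsub>?T\<^esub> = N"
    and T_add: "add ?T = set_mult F"
    and T_smult: "d \<odot>\<^bsub>?T\<^esub> C = (\<Union>x\<in>C. N #>\<^bsub>F\<^esub> s d x)" for d C
    by (simp_all add: tensor_field_def Let_def F_def N_def s_def)
  have T_cases: "\<exists>x\<in>carrier F. C = N #>\<^bsub>F\<^esub> x" if "C \<in> carrier ?T" for C
    using that by (auto simp: T_carrier RCOSETS_def)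
  have T_I: "N #>\<^bsub>F\<^esub> x \<in> carrier ?T" if "x \<in> carrier F" for x
    using that by (auto simp: T_carrier RCOSETS_def)
  have smult: "d \<odot>\<^bsub>?T\<^esub> (N #>\<^bsub>F\<^esub> x) = N #>\<^bsub>F\<^esub> s d x" if x: "x \<in> carrier F" and d: "d \<in> K" for d x
  proof -
    have "N #>\<^bsub>F\<^esub> s d y = N #>\<^bsub>F\<^esub> s d x" if hy: "y \<in> N #>\<^bsub>F\<^esub> x" for y
    proof -
      obtain h where h: "h \<in> N" "y = h + x" using hy by (auto simp: r_coset_def Fadd)
      have y: "y \<in> carrier F" using h x N.mem_carrier F.m_closed by (metis Fadd)
      have "s d y - s d x \<in> N" using s_N[OF h(1) d] by (simp add: h s_add)
      then show ?thesis using s_F[OF y d] s_F[OF x d] by (rule coset_eq)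
    qed
    moreover have "x \<in> N #>\<^bsub>F\<^esub> x" using F.rcos_self[OF x subN] .
    ultimately show ?thesis unfolding T_smult by blast
  qed
  have add: "(N #>\<^bsub>F\<^esub> x) \<oplus>\<^bsub>?T\<^esub> (N #>\<^bsub>F\<^esub> y) = N #>\<^bsub>F\<^esub> (x + y)"
    if "x \<in> carrier F" "y \<in> carrier F" for x y
    using N.rcos_sum[OF that] by (simp add: T_add Fadd)
  have s_l_distr: "s (a + b) x - (s a x + s b x) \<in> N" if "x \<in> carrier F" "a \<in> K" "b \<in> K" for a b x
  proof -
    have "Poly_Mapping.keys x \<subseteq> carrier L \<times> K"
      using that(1) by (simp add: F_def free_Abelian_group_def)
    then show ?thesis
    proof (induction rule: frag_induction)
      case zero
      then show ?case using N0 by (simp add: s_0)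
    next
      case (one y)
      obtain v c where y: "y = (v, c)" by (cases y)
      have "frag_of (v, a * c + b * c) - frag_of (v, a * c) - frag_of (v, b * c) \<in> tensor_relations K L"
        using one y that Kmult unfolding tensor_relations_def by blast
      then show ?case using rel_N by (simp add: y s_of distrib_right diff_diff_eq)
    next
      case (diff x y)
      have "s (a + b) (x - y) - (s a (x - y) + s b (x - y)) =
        (s (a + b) x - (s a x + s b x)) + - (s (a + b) y - (s a y + s b y))"
        by (simp add: s_diff)
      then show ?case using diff Nadd Nneg by metis
    qed
  qed
  have s_assoc: "s (a * b) x = s a (s b x)" for a b x
    by (rule frag_induction[of x UNIV "\<lambda>x. s (a * b) x = s a (s b x)"])
       (auto simp: s_0 s_diff s_of mult.assoc)
  have s_1: "s 1 x = x" for x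
    by (rule frag_induction[of x UNIV "\<lambda>x. s 1 x = x"]) (auto simp: s_0 s_diff s_of)
  have FC: "x + y \<in> carrier F" if "x \<in> carrier F" "y \<in> carrier F" for x y
    using F.m_closed[OF that] by (simp add: Fadd)
  have "abelian_group ?T"
  proof (rule abelian_groupI)
    fix C D E assume "C \<in> carrier ?T" "D \<in> carrier ?T" "E \<in> carrier ?T"
    then show "C \<oplus>\<^bsub>?T\<^esub> D \<oplus>\<^bsub>?T\<^esub> E = C \<oplus>\<^bsub>?T\<^esub> (D \<oplus>\<^bsub>?T\<^esub> E)"
      by (auto dest!: T_cases simp: add FC add.assoc)
  next
    fix C D assume "C \<in> carrier ?T" "D \<in> carrier ?T"
    then show "C \<oplus>\<^bsub>?T\<^esub> D \<in> carrier ?T" "C \<oplus>\<^bsub>?T\<^esub> D = D \<oplus>\<^bsub>?T\<^esub> C"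
      by (auto dest!: T_cases simp: add FC T_I add.commute)
  next
    have N_eq: "N = N #>\<^bsub>F\<^esub> 0"
      using F.coset_mult_one[OF N.subset] by (simp add: F0)
    have 0: "0 \<in> carrier F" using F.one_closed by (simp add: F0)
    show "\<zero>\<^bsub>?T\<^esub> \<in> carrier ?T"
      using T_I[OF 0] N_eq T_zero by simp
    fix C assume "C \<in> carrier ?T"
    then obtain x where x: "x \<in> carrier F" "C = N #>\<^bsub>F\<^esub> x" using T_cases by blast
    show "\<zero>\<^bsub>?T\<^esub> \<oplus>\<^bsub>?T\<^esub> C = C"
      using add[OF 0 x(1)] x N_eq T_zero by simp
    have "- x \<in> carrier F" using F.inv_closed[OF x(1)] Finv[OF x(1)] by simp
    then show "\<exists>D\<in>carrier ?T. D \<oplus>\<^bsub>?T\<^esub> C = \<zero>\<^bsub>?T\<^esub>"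
      using add[of "- x" x] x T_I N_eq T_zero by (metis add.left_inverse)
  qed
  moreover have "module_axioms (real_subring K) ?T"
  proof
    have RK: "carrier (real_subring K) = K" "a \<oplus>\<^bsub>real_subring K\<^esub> b = a + b"
      "a \<otimes>\<^bsub>real_subring K\<^esub> b = a * b" "\<one>\<^bsub>real_subring K\<^esub> = 1" for a b
      by (simp_all add: real_subring_def ring_of_type_algebra_def)
    fix a b C D
    assume a: "a \<in> carrier (real_subring K)" and C: "C \<in> carrier ?T"
    from a have a: "a \<in> K" by (simp add: RK)
    from C obtain x where x: "x \<in> carrier F" "C = N #>\<^bsub>F\<^esub> x" using T_cases by blast
    show "a \<odot>\<^bsub>?T\<^esub> C \<in> carrier ?T" using a x by (simp add: smult T_I s_F)
    {
      assume "D \<in> carrier ?T"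
      then obtain y where y: "y \<in> carrier F" "D = N #>\<^bsub>F\<^esub> y" using T_cases by blast
      show "a \<odot>\<^bsub>?T\<^esub> (C \<oplus>\<^bsub>?T\<^esub> D) = a \<odot>\<^bsub>?T\<^esub> C \<oplus>\<^bsub>?T\<^esub> a \<odot>\<^bsub>?T\<^esub> D"
        using a x y by (simp add: smult add s_F FC s_add)
    }
    assume "b \<in> carrier (real_subring K)"
    then have b: "b \<in> K" by (simp add: RK)
    show "(a \<oplus>\<^bsub>real_subring K\<^esub> b) \<odot>\<^bsub>?T\<^esub> C = a \<odot>\<^bsub>?T\<^esub> C \<oplus>\<^bsub>?T\<^esub> b \<odot>\<^bsub>?T\<^esub> C"
      using a b x coset_eq[OF s_l_distr[OF x(1) a b]] by (simp add: RK smult add s_F FC Kadd)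
    show "(a \<otimes>\<^bsub>real_subring K\<^esub> b) \<odot>\<^bsub>?T\<^esub> C = a \<odot>\<^bsub>?T\<^esub> (b \<odot>\<^bsub>?T\<^esub> C)"
      using a b x by (simp add: RK smult Kmult s_F s_assoc)
  next
    fix C assume "C \<in> carrier ?T"
    then show "\<one>\<^bsub>real_subring K\<^esub> \<odot>\<^bsub>?T\<^esub> C = C"
      using K1 by (auto dest!: T_cases simp: real_subring_def ring_of_type_algebra_def smult s_1)
  qed
  ultimately show ?thesis
    by (simp add: vectorspace_def Module.module_def K.is_cring K.field_axioms)
qed

end

theory Submission
  imports Defs "HOL-Computational_Algebra.Fundamental_Theorem_Algebra"
begin

text \<open>At most \<open>n\<close> classes are represented, whatever \<open>\<gamma>\<^sub>K\<close> is, and \<open>n \<le> 2 n - 2\<close> for \<open>n \<ge> 2\<close>.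

  If \<open>Q y\<close> is a unit, the reflection \<open>x \<mapsto> x - (2 B(x, y) / Q y) y\<close> preserves \<open>\<L>\<close> and \<open>Q\<close>. Let \<open>v\<^sub>1, \<dots>, v\<^sub>k\<close>
  represent distinct classes, and let the \<open>i\<close>-th roots be the vectors \<open>x\<close> with \<open>Q x = Q v\<^sub>i\<close> that are
  combinations of the \<open>v\<^sub>j\<close> with integral coefficients in the number field generated by the \<open>B(v\<^sub>i, v\<^sub>j)\<close>.
  There are finitely many of them: by the Cauchy--Schwarz inequality at every embedding of \<open>K\<close>, the algebraic
  integers \<open>2 B(x, v\<^sub>j)\<close> have bounded conjugates, and their degrees are bounded. As for simple systems of
  finite reflection groups, fix a linear height that vanishes on no root and let \<open>x\<^sub>i\<close> be an \<open>i\<close>-th root of least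
  positive height. If \<open>B(x\<^sub>i, x\<^sub>j) > 0\<close> for some \<open>i \<noteq> j\<close>, reflecting \<open>x\<^sub>i\<close> and \<open>x\<^sub>j\<close> in each other contradicts
  minimality unless \<open>B(x\<^sub>i, x\<^sub>j)\<^sup>2 = Q x\<^sub>i Q x\<^sub>j\<close>, and then the two classes agree. Hence the \<open>x\<^sub>i\<close> are pairwise
  obtuse and lie in an open half-space, so they are linearly independent and \<open>k \<le> n\<close>.\<close>

section \<open>Extending embeddings\<close>

text \<open>Graphs of ring homomorphisms from subrings of the real numbers to the complex numbers, written as
  sets of pairs so that Zorn's lemma applies to inclusion.\<close>

definition hom_graph :: "(real \<times> complex) set \<Rightarrow> bool" where
  "hom_graph G \<longleftrightarrow> (1, 1) \<in> G \<and>
     (\<forall>x y x' y'. (x, y) \<in> G \<and> (x', y') \<in> G \<longrightarrow> (x - x', y - y') \<in> G \<and> (x * x', y * y') \<in> G) \<and>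
     (\<forall>y. (0, y) \<in> G \<longrightarrow> y = 0)"

lemma hom_graph_one: "hom_graph G \<Longrightarrow> (1, 1) \<in> G"
  and hom_graph_diff: "hom_graph G \<Longrightarrow> (x, y) \<in> G \<Longrightarrow> (x', y') \<in> G \<Longrightarrow> (x - x', y - y') \<in> G"
  and hom_graph_mult: "hom_graph G \<Longrightarrow> (x, y) \<in> G \<Longrightarrow> (x', y') \<in> G \<Longrightarrow> (x * x', y * y') \<in> G"
  and hom_graph_zeroD: "hom_graph G \<Longrightarrow> (0, y) \<in> G \<Longrightarrow> y = 0"
  unfolding hom_graph_def by blast+

lemma hom_graph_zero: "hom_graph G \<Longrightarrow> (0, 0) \<in> G"
  using hom_graph_diff[OF _ hom_graph_one hom_graph_one] by simp

lemma hom_graph_add: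
  assumes "hom_graph G" "(x, y) \<in> G" "(x', y') \<in> G"
  shows "(x + x', y + y') \<in> G"
  using hom_graph_diff[OF assms(1,2) hom_graph_diff[OF assms(1) hom_graph_zero[OF assms(1)] assms(3)]]
  by simp

lemma hom_graph_of_nat: "hom_graph G \<Longrightarrow> (of_nat n, of_nat n) \<in> G"
  by (induction n) (auto simp: hom_graph_zero intro: hom_graph_add hom_graph_one)

lemma hom_graph_of_int: "hom_graph G \<Longrightarrow> (of_int n, of_int n) \<in> G"
  using hom_graph_diff[OF _ hom_graph_zero hom_graph_of_nat]
  by (cases n rule: int_cases2) (auto simp: hom_graph_of_nat)

lemma hom_graph_sum:
  assumes "hom_graph G" "\<And>i. i \<in> I \<Longrightarrow> (f i, g i) \<in> G"
  shows "(sum f I, sum g I) \<in> G"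
  using assms(2)
  by (induction I rule: infinite_finite_induct) (auto simp: hom_graph_zero[OF assms(1)] intro: hom_graph_add[OF assms(1)])

lemma hom_graph_poly_of_int:
  assumes "hom_graph G" "(x, y) \<in> G"
  shows "(poly (map_poly of_int p) x, poly (map_poly of_int p) y) \<in> G"
  by (induction p)
     (auto simp: map_poly_pCons assms hom_graph_zero hom_graph_of_int
           intro!: hom_graph_add[OF assms(1)] hom_graph_mult[OF assms(1)])

lemma hom_graph_functional:
  assumes "hom_graph G" "(x, y) \<in> G" "(x, y') \<in> G"
  shows "y = y'"
  using hom_graph_zeroD[OF assms(1)] hom_graph_diff[OF assms] by fastforce

text \<open>If \<open>q\<close> vanishes at \<open>x\<close>, its constant term lies over 0 in the
  graph and so is zero; dividing by \<open>x\<close> and repeating leaves only \<open>q = 0\<close>,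
  against algebraicity.\<close>

lemma hom_graph_algebraic_zero:
  assumes "hom_graph G" "(x, 0) \<in> G" "algebraic x"
  shows "x = 0"
proof (rule ccontr)
  assume "x \<noteq> 0"
  obtain p :: "int poly" where p: "p \<noteq> 0" "poly (map_poly of_int p) x = 0"
    using assms(3) by (elim algebraicE')
  have "poly (map_poly of_int q) x = 0 \<Longrightarrow> q = 0" for q :: "int poly"
  proof (induction q)
    case (pCons c q)
    have "(poly (map_poly of_int (pCons c q)) x, of_int c) \<in> G"
      using hom_graph_poly_of_int[OF assms(1,2), of "pCons c q"] by (simp add: map_poly_pCons)
    then have "(of_int c :: complex) = 0"
      using pCons.prems hom_graph_zeroD[OF assms(1)] by metis
    then show ?case
      using pCons \<open>x \<noteq> 0\<close> by (simp add: map_poly_pCons)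
  qed simp
  then show False using p by blast
qed

section \<open>Polynomials transported coefficientwise along a graph\<close>

definition graph_poly :: "(real \<times> complex) set \<Rightarrow> real poly \<Rightarrow> complex poly \<Rightarrow> bool" where
  "graph_poly G q q' \<longleftrightarrow> (\<forall>i. (coeff q i, coeff q' i) \<in> G)"

lemma graph_poly_diff:
  "hom_graph G \<Longrightarrow> graph_poly G p p' \<Longrightarrow> graph_poly G q q' \<Longrightarrow> graph_poly G (p - q) (p' - q')"
  by (auto simp: graph_poly_def intro: hom_graph_diff)

lemma graph_poly_mult:
  "hom_graph G \<Longrightarrow> graph_poly G p p' \<Longrightarrow> graph_poly G q q' \<Longrightarrow> graph_poly G (p * q) (p' * q')"
  by (auto simp: graph_poly_def coeff_mult intro!: hom_graph_sum hom_graph_mult)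

lemma graph_poly_monom:
  "hom_graph G \<Longrightarrow> (x, y) \<in> G \<Longrightarrow> graph_poly G (monom x n) (monom y n)"
  by (auto simp: graph_poly_def intro: hom_graph_zero)

lemma graph_poly_of_int:
  "hom_graph G \<Longrightarrow> graph_poly G (map_poly of_int p) (map_poly of_int p)"
  by (auto simp: graph_poly_def coeff_map_poly hom_graph_of_int)

text \<open>Division with remainder by a polynomial of minimal degree vanishing at \<open>a\<close>, carried out
  simultaneously on both sides of the graph.\<close>

lemma graph_poly_vanish:
  assumes G: "hom_graph G" and inj: "\<And>x. (x, 0) \<in> G \<Longrightarrow> x = 0"
    and p: "graph_poly G p p'" "p \<noteq> 0" "poly p a = 0" "poly p' b = 0"
    and min: "\<And>q q'. graph_poly G q q' \<Longrightarrow> q \<noteq> 0 \<Longrightarrow> poly q a = 0 \<Longrightarrow> degree p \<le> degree q"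
    and q: "graph_poly G q q'" "poly q a = 0"
  shows "poly q' b = 0"
  using q
proof (induction "degree q" arbitrary: q q' rule: less_induct)
  case less
  let ?c = "lead_coeff p" and ?c' = "coeff p' (degree p)"
  have c: "(?c, ?c') \<in> G" using p(1) by (simp add: graph_poly_def)
  have c': "?c' \<noteq> 0" using inj c p(2) by fastforce
  show ?case
  proof (cases "q = 0")
    case True
    then have "coeff q' i = 0" for i
      using less.prems hom_graph_zeroD[OF G] by (auto simp: graph_poly_def)
    then have "q' = 0" by (simp add: poly_eq_iff)
    then show ?thesis by simp
  next
    case False
    then have deg: "degree p \<le> degree q" using min less.prems by blast
    define k where "k = degree q - degree p"
    let ?d = "lead_coeff q" and ?d' = "coeff q' (degree q)"
    have d: "(?d, ?d') \<in> G" using less.prems by (simp add: graph_poly_def)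
    \<comment> \<open>Cross-multiplying by the two leading coefficients cancels the top terms
      without division, because the domain of \<open>G\<close> is only a ring.\<close>
    define r where "r = monom ?c 0 * q - monom ?d k * p"
    define r' where "r' = monom ?c' 0 * q' - monom ?d' k * p'"
    have r: "graph_poly G r r'"
      unfolding r_def r'_def
      by (intro graph_poly_diff graph_poly_mult graph_poly_monom G c d less.prems p)
    have r0: "poly r a = 0" using p(3) less.prems by (simp add: r_def)
    have "poly r' b = 0"
    proof (cases "degree q = 0")
      case True
      then obtain e where "q = [:e:]" using degree_eq_zeroE by blast
      then show ?thesis using less.prems False by simp
    next
      case nz: False
      have "degree (monom ?c 0 * q) \<le> degree q" by (simp add: monom_0)
      moreover have "degree (monom ?d k * p) \<le> degree q"
        using degree_mult_le[of "monom ?d k" p] degree_monom_le[of ?d k] deg by (simp add: k_def)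
      moreover have "coeff r (degree q) = 0"
      proof -
        have "coeff (monom ?d k * p) (degree q) = ?d * ?c"
          using deg by (simp add: coeff_monom_mult k_def)
        then show ?thesis by (simp add: r_def monom_0)
      qed
      ultimately have "degree r < degree q"
        using nz unfolding r_def
        by (metis (no_types, lifting) degree_diff_le leading_coeff_0_iff degree_0 le_neq_implies_less not_gr_zero)
      then show ?thesis using less.hyps r r0 by blast
    qed
    then have "?c' * poly q' b = 0" using p(4) by (simp add: r'_def monom_0)
    then show ?thesis using c' by simp
  qed
qed

text \<open>Evaluating at \<open>a\<close> and \<open>b\<close> extends the map by
  \<open>a \<mapsto> b\<close>. It is well defined by \<open>graph_poly_vanish\<close>: every
  relation satisfied by \<open>a\<close> is inherited by \<open>b\<close>.\<close>

lemma hom_graph_adjoin: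
  assumes G: "hom_graph G" and inj: "\<And>x. (x, 0) \<in> G \<Longrightarrow> x = 0"
    and p: "graph_poly G p p'" "p \<noteq> 0" "poly p a = 0" "poly p' b = 0"
    and min: "\<And>q q'. graph_poly G q q' \<Longrightarrow> q \<noteq> 0 \<Longrightarrow> poly q a = 0 \<Longrightarrow> degree p \<le> degree q"
  defines "H \<equiv> {(poly q a, poly q' b) |q q'. graph_poly G q q'}"
  shows "hom_graph H" "G \<subseteq> H" "(a, b) \<in> H"
proof -
  have const: "(x, y) \<in> H" if "(x, y) \<in> G" for x y
  proof -
    have "graph_poly G (monom x 0) (monom y 0)" using graph_poly_monom[OF G that] .
    then show ?thesis unfolding H_def by (force simp: monom_0)
  qed
  then show "G \<subseteq> H" by auto
  have "graph_poly G (monom 1 1) (monom 1 1)" using graph_poly_monom[OF G hom_graph_one[OF G]] .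
  then show "(a, b) \<in> H" unfolding H_def by (force simp: poly_monom)
  have "(x - x', y - y') \<in> H" "(x * x', y * y') \<in> H" if xy: "(x, y) \<in> H" "(x', y') \<in> H" for x y x' y'
  proof -
    obtain q q' r r' where *: "graph_poly G q q'" "x = poly q a" "y = poly q' b"
       "graph_poly G r r'" "x' = poly r a" "y' = poly r' b"
      using xy unfolding H_def by blast
    show "(x - x', y - y') \<in> H"
      using graph_poly_diff[OF G *(1,4)] * unfolding H_def by (force simp: poly_diff)
    show "(x * x', y * y') \<in> H"
      using graph_poly_mult[OF G *(1,4)] * unfolding H_def by (force simp: poly_mult)
  qed
  moreover have "y = 0" if "(0, y) \<in> H" for y
    using that graph_poly_vanish[OF G inj p min] unfolding H_def by fastforce
  ultimately show "hom_graph H"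
    using const[OF hom_graph_one[OF G]] unfolding hom_graph_def by blast
qed

locale tr_field =
  fixes K :: "real set"
  assumes K: "totally_real_field K"
begin

section \<open>Closure of \<open>K\<close> under the field operations\<close>

lemma field_K: "field (real_subring K)"
  using K by (rule field_real_subring)

lemma real_subring_sel [simp]:
  "carrier (real_subring S) = S" "x \<oplus>\<^bsub>real_subring S\<^esub> y = x + y"
  "x \<otimes>\<^bsub>real_subring S\<^esub> y = x * y" "\<one>\<^bsub>real_subring S\<^esub> = 1" "\<zero>\<^bsub>real_subring S\<^esub> = 0"
  by (simp_all add: real_subring_def ring_of_type_algebra_def)

lemma K_add: "x \<in> K \<Longrightarrow> y \<in> K \<Longrightarrow> x + y \<in> K"
  and K_mult: "x \<in> K \<Longrightarrow> y \<in> K \<Longrightarrow> x * y \<in> K"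
  and K_1: "1 \<in> K" and K_0: "0 \<in> K"
proof -
  interpret field "real_subring K" by (rule field_K)
  show "x \<in> K \<Longrightarrow> y \<in> K \<Longrightarrow> x + y \<in> K" using add.m_closed[of x y] by simp
  show "x \<in> K \<Longrightarrow> y \<in> K \<Longrightarrow> x * y \<in> K" using m_closed[of x y] by simp
  show "1 \<in> K" using one_closed by simp
  show "0 \<in> K" using zero_closed by simp
qed

lemma K_uminus: "x \<in> K \<Longrightarrow> - x \<in> K"
proof -
  interpret field "real_subring K" by (rule field_K)
  assume x: "x \<in> K"
  then obtain y where "y \<in> K" "y + x = 0" using add.l_inv_ex[of x] by auto
  then show "- x \<in> K" by (simp add: add_eq_0_iff2)
qed

lemma K_diff: "x \<in> K \<Longrightarrow> y \<in> K \<Longrightarrow> x - y \<in> K"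
  using K_add[of x "- y"] K_uminus by simp

lemma K_inverse: "x \<in> K \<Longrightarrow> inverse x \<in> K"
proof (cases "x = 0")
  case False
  interpret field "real_subring K" by (rule field_K)
  assume "x \<in> K"
  then have "x \<in> Units (real_subring K)" using False by (simp add: field_Units)
  then obtain y where "y \<in> K" "y * x = 1" by (auto simp: Units_def)
  then show ?thesis by (metis inverse_unique mult.commute)
qed simp

lemma K_divide: "x \<in> K \<Longrightarrow> y \<in> K \<Longrightarrow> x / y \<in> K"
  using K_mult[of x "inverse y"] K_inverse by (simp add: divide_inverse)

lemma K_of_nat: "of_nat n \<in> K"
  by (induction n) (auto simp: K_0 intro: K_add K_1)

lemma K_of_int: "of_int n \<in> K"
  by (cases n rule: int_cases2) (auto simp: K_of_nat intro: K_uminus)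

lemma K_algebraic: "x \<in> K \<Longrightarrow> algebraic x"
  using K by (auto simp: totally_real_field_def totally_real_def)

lemma K_power: "x \<in> K \<Longrightarrow> x ^ n \<in> K"
  by (induction n) (auto simp: K_1 intro: K_mult)

lemma K_sum: "(\<And>i. i \<in> I \<Longrightarrow> f i \<in> K) \<Longrightarrow> sum f I \<in> K"
  by (induction I rule: infinite_finite_induct) (auto simp: K_0 intro: K_add)

lemma K_poly: "(\<And>i. coeff p i \<in> K) \<Longrightarrow> x \<in> K \<Longrightarrow> poly p x \<in> K"
  by (auto simp: poly_altdef intro!: K_sum K_mult K_power)

lemma hom_graph_inj: "hom_graph G \<Longrightarrow> G \<subseteq> K \<times> UNIV \<Longrightarrow> (x, 0) \<in> G \<Longrightarrow> x = 0"
  using hom_graph_algebraic_zero K_algebraic by blast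

lemma adjoin_subset:
  assumes "G \<subseteq> K \<times> UNIV" "a \<in> K"
  shows "{(poly q a, poly q' b) |q q'. graph_poly G q q'} \<subseteq> K \<times> UNIV"
  using assms by (auto simp: graph_poly_def intro!: K_poly)

text \<open>The value \<open>b\<close> is a complex root of the image \<open>p'\<close> of a
  polynomial \<open>p\<close> that annihilates \<open>a\<close> and has least degree over the domain
  of \<open>G\<close>.\<close>

lemma hom_graph_extend:
  assumes G: "hom_graph G" "G \<subseteq> K \<times> UNIV" and a: "a \<in> K"
  shows "\<exists>H b. hom_graph H \<and> H \<subseteq> K \<times> UNIV \<and> G \<subseteq> H \<and> (a, b) \<in> H"
proof -
  define P where "P n \<longleftrightarrow> (\<exists>p p'. graph_poly G p p' \<and> p \<noteq> 0 \<and> poly p a = 0 \<and> degree p = n)" for n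
  obtain p0 :: "int poly" where p0: "p0 \<noteq> 0" "poly (map_poly of_int p0) a = 0"
    using K_algebraic[OF a] by (elim algebraicE')
  have "P (degree (map_poly of_int p0 :: real poly))"
    unfolding P_def using p0 graph_poly_of_int[OF G(1), of p0]
    by (intro exI[of _ "map_poly of_int p0"]) (auto simp: map_poly_eq_0_iff)
  then have "P (LEAST n. P n)" by (rule LeastI)
  then obtain p p' where p: "graph_poly G p p'" "p \<noteq> 0" "poly p a = 0" "degree p = (LEAST n. P n)"
    unfolding P_def by blast
  have min: "degree p \<le> degree q" if "graph_poly G q q'" "q \<noteq> 0" "poly q a = 0" for q q'
    unfolding p(4) using that by (intro Least_le) (auto simp: P_def)
  have "degree p \<noteq> 0"
  proof
    assume "degree p = 0"
    then obtain c where "p = [:c:]" by (rule degree_eq_zeroE)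
    then show False using p(2,3) by simp
  qed
  \<comment> \<open>Injectivity keeps the leading coefficient from vanishing, so \<open>p'\<close>
    is not constant.\<close>
  moreover have "coeff p' (degree p) \<noteq> 0"
    using hom_graph_inj[OF G] p(1,2) by (metis graph_poly_def leading_coeff_0_iff)
  ultimately have "degree p' \<noteq> 0" using le_degree by fastforce
  then have "\<exists>b. poly p' b = 0"
    by (intro fundamental_theorem_of_algebra_alt) auto
  then obtain b where b: "poly p' b = 0" by blast
  show ?thesis
    using hom_graph_adjoin[OF G(1) hom_graph_inj[OF G] p(1,2,3) b min] adjoin_subset[OF G(2) a]
    by meson
qed

text \<open>By Zorn's lemma: a union of a chain of graphs is a graph, and a maximal graph has domain
  \<open>K\<close>, since \<open>hom_graph_extend\<close> would enlarge any other.\<close>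

lemma hom_graph_total:
  assumes G: "hom_graph G" "G \<subseteq> K \<times> UNIV"
  shows "\<exists>H. hom_graph H \<and> H \<subseteq> K \<times> UNIV \<and> G \<subseteq> H \<and> (\<forall>x\<in>K. \<exists>y. (x, y) \<in> H)"
proof -
  define A where "A = {H. hom_graph H \<and> H \<subseteq> K \<times> UNIV \<and> G \<subseteq> H}"
  have "\<Union>C \<in> A" if C: "C \<noteq> {}" "subset.chain A C" for C
  proof -
    have CA: "C \<subseteq> A" and lin: "\<forall>U\<in>C. \<forall>W\<in>C. U \<subseteq> W \<or> W \<subseteq> U"
      using C(2) by (simp_all add: subset_chain_def)
    have memA: "hom_graph U" "U \<subseteq> K \<times> UNIV" "G \<subseteq> U" if "U \<in> C" for U
      using CA that by (auto simp: A_def)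
    have "hom_graph (\<Union>C)"
      unfolding hom_graph_def
    proof (intro conjI allI impI)
      show "(1, 1) \<in> \<Union>C" using C(1) memA hom_graph_one by blast
    next
      fix y :: complex assume "(0, y) \<in> \<Union>C"
      then show "y = 0" using memA hom_graph_zeroD by blast
    next
      fix x y x' y' assume "(x, y) \<in> \<Union>C \<and> (x', y') \<in> \<Union>C"
      then obtain U where U: "U \<in> C" "(x, y) \<in> U" "(x', y') \<in> U" using lin by blast
      show "(x - x', y - y') \<in> \<Union>C" "(x * x', y * y') \<in> \<Union>C"
        using hom_graph_diff hom_graph_mult memA U by blast+
    qed
    then show ?thesis using memA C(1) unfolding A_def by blast
  qed
  moreover have "A \<noteq> {}" using G by (auto simp: A_def)
  ultimately obtain M where M: "M \<in> A" "\<forall>U\<in>A. M \<subseteq> U \<longrightarrow> U = M"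
    using subset_Zorn_nonempty[of A] by blast
  have "\<exists>y. (x, y) \<in> M" if "x \<in> K" for x
  proof -
    obtain H b where H: "hom_graph H" "H \<subseteq> K \<times> UNIV" "M \<subseteq> H" "(x, b) \<in> H"
      using hom_graph_extend[OF _ _ \<open>x \<in> K\<close>] M(1) unfolding A_def by blast
    then have "H = M" using M unfolding A_def by blast
    then show ?thesis using H(4) by blast
  qed
  then show ?thesis using M(1) unfolding A_def by blast
qed

text \<open>Totality gives \<open>1 / b\<close> some image, and multiplying by \<open>b\<close>
  forces this image to be \<open>1 / b\<close>.\<close>

lemma hom_graph_of_rat:
  assumes H: "hom_graph H" "\<forall>x\<in>K. \<exists>y. (x, y) \<in> H"
  shows "(of_rat q, of_rat q) \<in> H"
proof -
  obtain a b where q: "q = Rat.Fract a b" "b > 0" by (cases q)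
  have "1 / of_int b \<in> K" by (intro K_divide K_1 K_of_int)
  then obtain w where w: "(1 / of_int b, w) \<in> H" using H(2) by blast
  from hom_graph_mult[OF H(1) hom_graph_of_int[OF H(1), of b] w] q(2)
  have "of_int b * w = 1"
    using hom_graph_functional[OF H(1) _ hom_graph_one[OF H(1)]] by simp
  then have "w = 1 / of_int b" using q(2) by (simp add: field_simps)
  then show ?thesis
    using hom_graph_mult[OF H(1) hom_graph_of_int[OF H(1), of a] w] q by (simp add: of_rat_rat)
qed

text \<open>The image \<open>y\<close> is a root of the rational polynomial of least degree that
  annihilates \<open>x\<close>. This polynomial is irreducible, so total reality of \<open>x\<close>
  makes all its complex roots real.\<close>

lemma hom_graph_real:
  assumes H: "hom_graph H" "\<forall>x\<in>K. \<exists>y. (x, y) \<in> H" and xy: "(x, y) \<in> H" and x: "x \<in> K"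
  shows "y \<in> \<real>"
proof -
  define P where "P n \<longleftrightarrow> (\<exists>p :: rat poly. p \<noteq> 0 \<and> poly (map_poly of_rat p) x = 0 \<and> degree p = n)" for n
  obtain p0 :: "int poly" where p0: "p0 \<noteq> 0" "poly (map_poly of_int p0) x = 0"
    using K_algebraic[OF x] by (elim algebraicE')
  have "map_poly of_rat (map_poly of_int p0) = (map_poly of_int p0 :: real poly)"
    by (simp add: map_poly_map_poly comp_def)
  then have "P (degree (map_poly of_int p0 :: rat poly))"
    unfolding P_def using p0 by (intro exI[of _ "map_poly of_int p0"]) (auto simp: map_poly_eq_0_iff)
  then have "P (LEAST n. P n)" by (rule LeastI)
  then obtain p where p: "p \<noteq> 0" "poly (map_poly of_rat p) x = 0" "degree p = (LEAST n. P n)"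
    unfolding P_def by blast
  have min: "degree p \<le> degree q" if "q \<noteq> 0" "poly (map_poly of_rat q) x = 0" for q
    unfolding p(3) using that by (intro Least_le) (auto simp: P_def)
  have mult: "map_poly of_rat (q * r) = (map_poly of_rat q * map_poly of_rat r :: real poly)" for q r
    by (rule poly_eqI) (simp add: coeff_map_poly coeff_mult of_rat_sum of_rat_mult)
  have "irreducible p"
  proof (rule irreducibleI)
    show "p \<noteq> 0" by fact
    show "\<not> is_unit p"
    proof
      assume "is_unit p"
      then obtain c where "p = [:c:]" "c \<noteq> 0" using p(1) by (auto simp: is_unit_poly_iff)
      then show False using p(2) by (simp add: map_poly_pCons)
    qed
    fix q r assume qr: "p = q * r"
    \<comment> \<open>A factor that vanishes at \<open>x\<close> already has the least degree, so
      its cofactor is constant.\<close>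
    have *: "is_unit s" if "p = q * s" "poly (map_poly of_rat q) x = 0" for q s
    proof -
      have nz: "q \<noteq> 0" "s \<noteq> 0" using p(1) that(1) by auto
      then have "degree s = 0"
        using min[OF nz(1) that(2)] that(1) by (simp add: degree_mult_eq)
      then show ?thesis using nz by (simp add: is_unit_iff_degree)
    qed
    have "poly (map_poly of_rat q) x = 0 \<or> poly (map_poly of_rat r) x = 0"
      using p(2) by (simp add: qr mult)
    then show "is_unit q \<or> is_unit r"
      using *[of q r] *[of r q] qr by (auto simp: mult.commute)
  qed
  moreover have "(poly (map_poly of_rat q) x, poly (map_poly of_rat q) y) \<in> H" for q
    by (induction q)
       (auto simp: map_poly_pCons xy hom_graph_zero[OF H(1)] hom_graph_of_rat[OF H]
             intro!: hom_graph_add[OF H(1)] hom_graph_mult[OF H(1)])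
  then have "poly (map_poly of_rat p) y = 0"
    using p(2) hom_graph_zeroD[OF H(1)] by metis
  ultimately show ?thesis
    using K x p(2) unfolding totally_real_field_def totally_real_def by blast
qed

text \<open>Start from the inclusion of the integers, send \<open>y\<close> to \<open>z\<close>, and
  extend to \<open>K\<close>; the values are real by \<open>hom_graph_real\<close>. So every complex
  conjugate of \<open>y\<close> comes from a real embedding.\<close>

lemma ex_embedding:
  assumes y: "y \<in> K" and p: "p \<noteq> 0" "poly (map_poly of_int p) y = 0"
    and min: "\<And>q. q \<noteq> 0 \<Longrightarrow> poly (map_poly of_int q) y = 0 \<Longrightarrow> degree p \<le> degree q"
    and z: "poly (map_poly of_int p) z = 0"
  shows "\<exists>\<sigma>\<in>real_embeddings K. z = complex_of_real (\<sigma> y)"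
proof -
  define G where "G = range (\<lambda>n. (real_of_int n, complex_of_int n))"
  have G: "hom_graph G"
    unfolding hom_graph_def
  proof (intro conjI allI impI)
    show "(1, 1) \<in> G" unfolding G_def by (rule range_eqI[of _ _ 1]) simp
  next
    fix y :: complex assume "(0, y) \<in> G"
    then show "y = 0" by (auto simp: G_def)
  next
    fix x y x' y' assume "(x, y) \<in> G \<and> (x', y') \<in> G"
    then obtain m n where "x = of_int m" "y = of_int m" "x' = of_int n" "y' = of_int n"
      by (auto simp: G_def)
    then show "(x - x', y - y') \<in> G" "(x * x', y * y') \<in> G"
      unfolding G_def by (simp_all flip: of_int_diff of_int_mult)
  qed
  have GK: "G \<subseteq> K \<times> UNIV" using K_of_int by (auto simp: G_def)
  \<comment> \<open>Polynomials over \<open>G\<close> are integer polynomials, so \<open>min\<close>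
    is the minimality that adjunction asks for.\<close>
  have min': "degree (map_poly of_int p :: real poly) \<le> degree q"
    if q: "graph_poly G q q'" "q \<noteq> 0" "poly q y = 0" for q q'
  proof -
    have "\<forall>i. coeff q i \<in> \<int>"
    proof
      fix i
      have "(coeff q i, coeff q' i) \<in> G" using q(1) by (simp add: graph_poly_def)
      then show "coeff q i \<in> \<int>" by (auto simp: G_def)
    qed
    then obtain r :: "int poly" where r: "q = map_poly of_int r"
      using intpolyE by blast
    then show ?thesis using min[of r] q by (auto simp: degree_map_poly map_poly_eq_0_iff)
  qed
  have p': "(map_poly of_int p :: real poly) \<noteq> 0" using p(1) by (simp add: map_poly_eq_0_iff)
  define G' where "G' = {(poly q y, poly q' z) |q q'. graph_poly G q q'}"
  have G': "hom_graph G'" "(y, z) \<in> G'"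
    unfolding G'_def
    by (rule hom_graph_adjoin[OF G hom_graph_inj[OF G GK] graph_poly_of_int[OF G] p' p(2) z min'],
        assumption+)+
  have G'K: "G' \<subseteq> K \<times> UNIV"
    unfolding G'_def by (rule adjoin_subset[OF GK y])
  obtain H where H: "hom_graph H" "H \<subseteq> K \<times> UNIV" "G' \<subseteq> H" "\<forall>x\<in>K. \<exists>y. (x, y) \<in> H"
    using hom_graph_total[OF G'(1) G'K] by blast
  \<comment> \<open>On \<open>K\<close> the values are real, so \<open>Re\<close> loses nothing; off
    \<open>K\<close> they are arbitrary, and \<open>ring_hom\<close> does not constrain them
    there.\<close>
  define \<sigma> where "\<sigma> x = Re (THE y. (x, y) \<in> H)" for x
  have \<sigma>: "complex_of_real (\<sigma> x) = w" if "(x, w) \<in> H" for x w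
  proof -
    have "(THE y. (x, y) \<in> H) = w" 
    proof (rule the_equality)
      show "v = w" if "(x, v) \<in> H" for v
        by (rule hom_graph_functional[OF H(1) that \<open>(x, w) \<in> H\<close>])
    qed (rule that)
    moreover have "x \<in> K" using H(2) that by blast
    then have "complex_of_real (Re w) = w" using hom_graph_real[OF H(1,4) that] by simp
    ultimately show ?thesis by (simp add: \<sigma>_def)
  qed
  have \<sigma>H: "(x, complex_of_real (\<sigma> x)) \<in> H" if x: "x \<in> K" for x
  proof -
    obtain w where w: "(x, w) \<in> H" using H(4) x by blast
    show ?thesis unfolding \<sigma>[OF w] by (rule w)
  qed
  have "\<sigma> (a * b) = \<sigma> a * \<sigma> b" "\<sigma> (a + b) = \<sigma> a + \<sigma> b" if ab: "a \<in> K" "b \<in> K" for a b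
  proof -
    have "complex_of_real (\<sigma> (a * b)) = of_real (\<sigma> a) * of_real (\<sigma> b)"
      by (rule \<sigma>[OF hom_graph_mult[OF H(1) \<sigma>H[OF ab(1)] \<sigma>H[OF ab(2)]]])
    then show "\<sigma> (a * b) = \<sigma> a * \<sigma> b" by (simp only: of_real_mult[symmetric] of_real_eq_iff)
    have "complex_of_real (\<sigma> (a + b)) = of_real (\<sigma> a) + of_real (\<sigma> b)"
      by (rule \<sigma>[OF hom_graph_add[OF H(1) \<sigma>H[OF ab(1)] \<sigma>H[OF ab(2)]]])
    then show "\<sigma> (a + b) = \<sigma> a + \<sigma> b" by (simp only: of_real_add[symmetric] of_real_eq_iff)
  qed
  moreover have "\<sigma> 1 = 1" using \<sigma>[OF hom_graph_one[OF H(1)]] by simp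
  ultimately have "\<sigma> \<in> real_embeddings K"
    unfolding real_embeddings_def
    by (intro ring_hom_memI) (simp_all add: ring_of_type_algebra_def)
  moreover have "z = complex_of_real (\<sigma> y)" using \<sigma>[of y z] G'(2) H(3) by auto
  ultimately show ?thesis by blast
qed

end

section \<open>Finiteness of integers with bounded conjugates\<close>

text \<open>A form of Gauss's lemma: pseudo-division of a monic annihilator \<open>P\<close> by the
  primitive annihilator \<open>p\<close> of least degree leaves no remainder, and contents and
  leading coefficients then show that \<open>p\<close> is monic up to sign.\<close>

lemma ex_monic_min_int_poly:
  fixes y :: "'a :: field_char_0"
  assumes "algebraic_int y"
  shows "\<exists>p :: int poly. lead_coeff p = 1 \<and> poly (map_poly of_int p) y = 0 \<and>
           (\<forall>q :: int poly. q \<noteq> 0 \<longrightarrow> poly (map_poly of_int q) y = 0 \<longrightarrow> degree p \<le> degree q)"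
proof -
  obtain P :: "int poly" where P: "poly (map_poly of_int P) y = 0" "lead_coeff P = 1"
    using assms by (auto simp: algebraic_int_altdef_ipoly)
  define D where "D n \<longleftrightarrow> (\<exists>p :: int poly. p \<noteq> 0 \<and> poly (map_poly of_int p) y = 0 \<and> degree p = n)" for n
  have "D (degree P)" unfolding D_def using P by (intro exI[of _ P]) auto
  then have "D (LEAST n. D n)" by (rule LeastI)
  then obtain p0 where p0: "p0 \<noteq> 0" "poly (map_poly of_int p0) y = 0" "degree p0 = (LEAST n. D n)"
    unfolding D_def by blast
  have min0: "degree p0 \<le> degree q" if "q \<noteq> 0" "poly (map_poly of_int q) y = 0" for q :: "int poly"
    unfolding p0(3) using that by (intro Least_le) (auto simp: D_def)
  have ev_smult: "poly (map_poly of_int (smult c q)) y = of_int c * poly (map_poly of_int q) y" for c q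
    by (simp add: map_poly_smult)
  have ev_mult: "poly (map_poly of_int (q * r)) y = poly (map_poly of_int q) y * poly (map_poly of_int r) y"
    and ev_add: "poly (map_poly of_int (q + r)) y = poly (map_poly of_int q) y + poly (map_poly of_int r) y" for q r
  proof -
    have "map_poly of_int (q * r) = (map_poly of_int q * map_poly of_int r :: 'a poly)"
      by (rule poly_eqI) (simp add: coeff_map_poly coeff_mult)
    then show "poly (map_poly of_int (q * r)) y = poly (map_poly of_int q) y * poly (map_poly of_int r) y"
      by simp
    have "map_poly of_int (q + r) = (map_poly of_int q + map_poly of_int r :: 'a poly)"
      by (rule poly_eqI) (simp add: coeff_map_poly)
    then show "poly (map_poly of_int (q + r)) y = poly (map_poly of_int q) y + poly (map_poly of_int r) y"
      by simp
  qed
  define p where "p = primitive_part p0"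
  have "p0 = smult (content p0) p" by (simp add: p_def)
  then have p: "p \<noteq> 0" "poly (map_poly of_int p) y = 0" "degree p = degree p0" "content p = 1"
    using p0 ev_smult[of "content p0" p] by (auto simp: p_def)
  obtain q r where qr: "pseudo_divmod P p = (q, r)" by force
  define k where "k = Suc (degree P) - degree p"
  let ?c = "lead_coeff p"
  have eq: "smult (?c ^ k) P = p * q + r" and r: "r = 0 \<or> degree r < degree p"
    using pseudo_divmod[OF p(1) qr] by (auto simp: k_def)
  have "poly (map_poly of_int r) y = 0"
    using arg_cong[OF eq, of "\<lambda>f. poly (map_poly of_int f) y"] P(1) p(2)
    by (simp add: ev_smult ev_mult ev_add)
  then have "r = 0" using r min0[of r] p(3) by fastforce
  then have eq: "smult (?c ^ k) P = p * q" using eq by simp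
  have "content P dvd lead_coeff P" by (rule content_dvd_coeff)
  then have "content P = 1" 
    using P(2) normalize_content[of P] by (simp add: is_unit_normalize)
  \<comment> \<open>Both \<open>P\<close> and \<open>p\<close> have content 1, so all the content
    sits in \<open>q\<close>. As \<open>?c ^ k\<close> divides the leading coefficient of
    \<open>q\<close> and equals \<open>?c\<close> times it, \<open>?c\<close> is a unit.\<close>
  then have "content q = \<bar>?c ^ k\<bar>"
    using arg_cong[OF eq, of content] p(4) by (simp add: content_mult)
  then have "?c ^ k dvd lead_coeff q" using content_dvd_coeff[of q "degree q"] by (metis abs_dvd_iff)
  moreover have "?c ^ k = ?c * lead_coeff q"
    using arg_cong[OF eq, of lead_coeff] P(2) p(1) by (simp add: lead_coeff_mult)
  moreover have "q \<noteq> 0" using eq P(2) p(1) by auto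
  ultimately have "\<bar>?c\<bar> = 1" by auto
  then consider "lead_coeff p = 1" | "lead_coeff (- p) = 1" by fastforce
  then show ?thesis
  proof cases
    case 1
    then show ?thesis using p min0 by (intro exI[of _ p]) auto
  next
    case 2
    have "poly (map_poly of_int (- p)) y = 0" using ev_smult[of "-1" p] p(2) by simp
    then show ?thesis using 2 p(3) min0 by (intro exI[of _ "- p"]) auto
  qed
qed

text \<open>Each linear factor enlarges the coefficient bound by at most the factor
  \<open>1 + C\<close>.\<close>

lemma coeff_prod_linear_bound:
  fixes Z :: "complex set"
  assumes "finite Z" "\<And>z. z \<in> Z \<Longrightarrow> norm z \<le> C" "C \<ge> 0"
  shows "norm (coeff (\<Prod>z\<in>Z. [:-z, 1:]) i) \<le> (1 + C) ^ card Z"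
  using assms(1,2)
proof (induction Z arbitrary: i rule: finite_induct)
  case empty
  show ?case by (cases i) auto
next
  case (insert z Z)
  let ?q = "\<Prod>z\<in>Z. [:-z, 1:]" and ?M = "(1 + C) ^ card Z"
  have IH: "norm (coeff ?q j) \<le> ?M" for j using insert by simp
  have M: "0 \<le> ?M" using assms(3) by simp
  have "coeff ([:-z, 1:] * ?q) i = coeff (pCons 0 ?q) i - z * coeff ?q i" by simp
  then have "norm (coeff ([:-z, 1:] * ?q) i) \<le> norm (coeff (pCons 0 ?q) i) + norm z * norm (coeff ?q i)"
    by (metis norm_mult norm_triangle_ineq4)
  also have "\<dots> \<le> ?M + C * ?M"
    using IH M insert.prems[of z] assms(3)
    by (intro add_mono mult_mono) (auto simp: coeff_pCons split: nat.split)
  finally show ?case using insert.hyps by (simp add: algebra_simps)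
qed

lemma finite_bounded_int_polys: "finite {p :: int poly. degree p \<le> N \<and> (\<forall>i. \<bar>coeff p i\<bar> \<le> B)}"
proof (rule finite_subset)
  show "{p. degree p \<le> N \<and> (\<forall>i. \<bar>coeff p i\<bar> \<le> B)} \<subseteq> Poly ` {xs. set xs \<subseteq> {-B..B} \<and> length xs \<le> Suc N}"
  proof
    fix p assume p: "p \<in> {p. degree p \<le> N \<and> (\<forall>i. \<bar>coeff p i\<bar> \<le> B)}"
    have "set (coeffs p) \<subseteq> {-B..B}"
    proof
      fix c assume "c \<in> set (coeffs p)"
      then obtain i where "c = coeff p i" by (auto simp: coeffs_def split: if_splits)
      then have "\<bar>c\<bar> \<le> B" using p by auto
      then show "c \<in> {-B..B}" by auto
    qed
    moreover have "length (coeffs p) \<le> Suc N"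
      using p by (cases "p = 0") (auto simp: length_coeffs_degree)
    ultimately show "p \<in> Poly ` {xs. set xs \<subseteq> {-B..B} \<and> length xs \<le> Suc N}"
      by (intro image_eqI[of _ _ "coeffs p"]) auto
  qed
  show "finite (Poly ` {xs. set xs \<subseteq> {-B..B} \<and> length xs \<le> Suc N})"
    by (intro finite_imageI finite_lists_length_le) auto
qed

section \<open>Arithmetic of the embeddings of \<open>K\<close>\<close>

context tr_field
begin

lemma
  assumes "\<sigma> \<in> real_embeddings K"
  shows emb_add: "x \<in> K \<Longrightarrow> y \<in> K \<Longrightarrow> \<sigma> (x + y) = \<sigma> x + \<sigma> y"
    and emb_mult: "x \<in> K \<Longrightarrow> y \<in> K \<Longrightarrow> \<sigma> (x * y) = \<sigma> x * \<sigma> y"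
    and emb_1: "\<sigma> 1 = 1"
  using assms ring_hom_add[of \<sigma> "real_subring K" ring_of_type_algebra x y]
    ring_hom_mult[of \<sigma> "real_subring K" ring_of_type_algebra x y]
    ring_hom_one[of \<sigma> "real_subring K" ring_of_type_algebra]
  by (simp_all add: real_embeddings_def ring_of_type_algebra_def)

lemma emb_0: "\<sigma> \<in> real_embeddings K \<Longrightarrow> \<sigma> 0 = 0"
  using emb_add[of \<sigma> 0 0] K_0 by simp

lemma emb_uminus: "\<sigma> \<in> real_embeddings K \<Longrightarrow> x \<in> K \<Longrightarrow> \<sigma> (- x) = - \<sigma> x"
  using emb_add[of \<sigma> x "- x"] emb_0[of \<sigma>] K_uminus[of x] by simp

lemma emb_diff: "\<sigma> \<in> real_embeddings K \<Longrightarrow> x \<in> K \<Longrightarrow> y \<in> K \<Longrightarrow> \<sigma> (x - y) = \<sigma> x - \<sigma> y"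
  using emb_add[of \<sigma> x "- y"] emb_uminus[of \<sigma> y] K_uminus[of y] by simp

lemma emb_inverse:
  assumes "\<sigma> \<in> real_embeddings K" "x \<in> K"
  shows "\<sigma> (inverse x) = inverse (\<sigma> x)"
proof (cases "x = 0")
  case False
  then have "\<sigma> x * \<sigma> (inverse x) = 1"
    using emb_mult[OF assms(1,2) K_inverse[OF assms(2)]] emb_1[OF assms(1)] by simp
  then show ?thesis by (metis inverse_unique)
qed (simp add: emb_0 assms)

lemma emb_eq_0D: "\<sigma> \<in> real_embeddings K \<Longrightarrow> x \<in> K \<Longrightarrow> \<sigma> x = 0 \<Longrightarrow> x = 0"
  using K_inverse[of x] emb_mult[of \<sigma> x "inverse x"] emb_1[of \<sigma>] by (cases "x = 0") auto

lemma emb_of_nat: "\<sigma> \<in> real_embeddings K \<Longrightarrow> \<sigma> (of_nat n) = of_nat n"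
  by (induction n) (auto simp: emb_0 emb_1 emb_add K_1 K_of_nat)

lemma emb_of_int: "\<sigma> \<in> real_embeddings K \<Longrightarrow> \<sigma> (of_int n) = of_int n"
  by (cases n rule: int_cases2) (auto simp: emb_of_nat emb_uminus K_of_nat)

lemma K_int_poly: "y \<in> K \<Longrightarrow> poly (map_poly of_int p) y \<in> K"
  by (intro K_poly) (auto simp: coeff_map_poly K_of_int)

lemma emb_int_poly:
  assumes "\<sigma> \<in> real_embeddings K" "y \<in> K"
  shows "\<sigma> (poly (map_poly of_int p) y) = poly (map_poly of_int p) (\<sigma> y)"
  by (induction p)
     (simp_all add: map_poly_pCons emb_0 emb_add emb_mult emb_of_int assms K_of_int K_mult K_int_poly)

lemma id_embedding: "(\<lambda>x. x) \<in> real_embeddings K"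
  unfolding real_embeddings_def by (intro ring_hom_memI) (simp_all add: ring_of_type_algebra_def)

text \<open>All these values are roots of one integer polynomial that annihilates
  \<open>y\<close>.\<close>

lemma finite_emb_values: "y \<in> K \<Longrightarrow> finite {\<sigma> y |\<sigma>. \<sigma> \<in> real_embeddings K}"
proof -
  assume y: "y \<in> K"
  obtain p :: "int poly" where p: "p \<noteq> 0" "poly (map_poly of_int p) y = 0"
    using K_algebraic[OF y] by (elim algebraicE')
  then have "{\<sigma> y |\<sigma>. \<sigma> \<in> real_embeddings K} \<subseteq> {w. poly (map_poly of_int p) w = 0}"
    using emb_int_poly[OF _ y, of _ p] emb_0 by auto
  moreover have "finite {w :: real. poly (map_poly of_int p) w = 0}"
    using p(1) by (intro poly_roots_finite) (simp add: map_poly_eq_0_iff)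
  ultimately show ?thesis by (rule finite_subset)
qed

text \<open>By Galois theory this is the subfield generated by \<open>S\<close>.\<close>

definition determined_by :: "real set \<Rightarrow> real set" where
  "determined_by S = {y \<in> K. \<forall>\<sigma>\<in>real_embeddings K. \<forall>\<tau>\<in>real_embeddings K.
     (\<forall>s\<in>S. \<sigma> s = \<tau> s) \<longrightarrow> \<sigma> y = \<tau> y}"

text \<open>The minimal polynomial of \<open>y\<close> has the values \<open>\<sigma> y\<close> as its (simple) roots; if \<open>y\<close> is determined by
  \<open>S\<close>, their number is bounded by the number of restrictions of embeddings to \<open>S\<close>.\<close>

lemma finite_bounded_integers:
  assumes S: "finite S" "S \<subseteq> K"
  shows "finite {y \<in> determined_by S. algebraic_int y \<and> (\<forall>\<sigma>\<in>real_embeddings K. \<bar>\<sigma> y\<bar> \<le> C)}"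
proof -
  let ?E = "real_embeddings K"
  \<comment> \<open>There may be infinitely many embeddings, but their restrictions to
    \<open>S\<close> are finite in number, since each element of \<open>S\<close> takes finitely
    many values.\<close>
  define R where "R = (\<lambda>\<sigma>. restrict \<sigma> S) ` ?E"
  have "R \<subseteq> (\<Pi>\<^sub>E s\<in>S. {\<sigma> s |\<sigma>. \<sigma> \<in> ?E})" by (auto simp: R_def)
  then have finR: "finite R"
    using S finite_emb_values by (elim finite_subset) (auto intro!: finite_PiE)
  define N where "N = card R"
  define C' where "C' = \<bar>C\<bar>"
  \<comment> \<open>The bound depends only on \<open>S\<close> and \<open>C\<close>, so one finite
    set \<open>P\<close> of polynomials serves every \<open>y\<close>.\<close>
  define B where "B = \<lceil>(1 + C') ^ N\<rceil>"
  define P where "P = {p :: int poly. degree p \<le> N \<and> (\<forall>i. \<bar>coeff p i\<bar> \<le> B)}"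
  have "y \<in> (\<Union>p\<in>P - {0}. {w. poly (map_poly of_int p) w = 0})"
    if y: "y \<in> determined_by S" "algebraic_int y" "\<forall>\<sigma>\<in>?E. \<bar>\<sigma> y\<bar> \<le> C" for y
  proof -
    have yK: "y \<in> K" using y(1) by (simp add: determined_by_def)
    obtain p :: "int poly" where p: "lead_coeff p = 1" "poly (map_poly of_int p) y = 0"
      and min: "\<And>q :: int poly. q \<noteq> 0 \<Longrightarrow> poly (map_poly of_int q) y = 0 \<Longrightarrow> degree p \<le> degree q"
      using ex_monic_min_int_poly[OF y(2)] by blast
    have p0: "p \<noteq> 0" using p(1) by auto
    let ?p = "map_poly of_int p :: complex poly"
    have deg: "degree ?p = degree p" and lead: "lead_coeff ?p = 1" 
      using p(1) by (simp_all add: degree_map_poly coeff_map_poly)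
    have emb: "\<exists>\<sigma>\<in>?E. z = complex_of_real (\<sigma> y)" if "poly ?p z = 0" for z
      using ex_embedding[OF yK p0 p(2) min that] .
    have degp: "degree p \<noteq> 0"
    proof
      assume "degree p = 0"
      then obtain c where "p = [:c:]" by (rule degree_eq_zeroE)
      then show False using p by (simp add: map_poly_pCons)
    qed
    \<comment> \<open>A double root would pull back along an injective \<open>\<sigma>\<close> and
      make \<open>y\<close> a root of the derivative of \<open>p\<close>, whose degree is too
      small.\<close>
    have "rsquarefree ?p"
      unfolding rsquarefree_roots
    proof (intro allI notI)
      fix z assume z: "poly ?p z = 0 \<and> poly (pderiv ?p) z = 0"
      then obtain \<sigma> where \<sigma>: "\<sigma> \<in> ?E" "z = complex_of_real (\<sigma> y)" using emb by blast
      have "pderiv ?p = map_poly of_int (pderiv p)"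
        by (rule poly_eqI) (simp add: coeff_pderiv coeff_map_poly)
      moreover have "poly (map_poly of_int q) (complex_of_real w) = complex_of_real (poly (map_poly of_int q) w)"
        for q :: "int poly" and w
        by (induction q) (simp_all add: map_poly_pCons)
      ultimately have "poly (map_poly of_int (pderiv p)) (\<sigma> y) = 0" using z \<sigma> by simp
      then have "poly (map_poly of_int (pderiv p)) y = 0"
        using emb_int_poly[OF \<sigma>(1) yK, of "pderiv p"] emb_eq_0D[OF \<sigma>(1) K_int_poly[OF yK]] by simp
      moreover have "pderiv p \<noteq> 0" using degp by (simp add: pderiv_eq_0_iff)
      ultimately show False using min[of "pderiv p"] degp by (simp add: degree_pderiv)
    qed
    define Z where "Z = {z. poly ?p z = 0}"
    have prod: "?p = (\<Prod>z\<in>Z. [:-z, 1:])"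
      using complex_poly_decompose_rsquarefree[OF \<open>rsquarefree ?p\<close>] lead by (simp add: Z_def)
    have finZ: "finite Z" unfolding Z_def using lead by (intro poly_roots_finite) auto
    have "degree ?p = card Z" unfolding prod by (subst degree_prod_sum_eq) auto
    \<comment> \<open>Since \<open>y\<close> is determined by \<open>S\<close>, any embedding with
      the same restriction to \<open>S\<close> gives the same root, so there are at most as many
      roots as elements of \<open>R\<close>.\<close>
    have "Z \<subseteq> (\<lambda>\<rho>. complex_of_real ((SOME \<sigma>. \<sigma> \<in> ?E \<and> restrict \<sigma> S = \<rho>) y)) ` R"
    proof
      fix z assume "z \<in> Z"
      then obtain \<sigma> where \<sigma>: "\<sigma> \<in> ?E" "z = complex_of_real (\<sigma> y)" using emb by (auto simp: Z_def)
      define \<tau> where "\<tau> = (SOME \<tau>. \<tau> \<in> ?E \<and> restrict \<tau> S = restrict \<sigma> S)"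
      have \<tau>: "\<tau> \<in> ?E \<and> restrict \<tau> S = restrict \<sigma> S"
        unfolding \<tau>_def by (rule someI[of _ \<sigma>]) (simp add: \<sigma>)
      then have "\<forall>s\<in>S. \<tau> s = \<sigma> s" by (metis restrict_apply')
      then have "\<tau> y = \<sigma> y" using y(1) \<tau> \<sigma>(1) by (auto simp: determined_by_def)
      then show "z \<in> (\<lambda>\<rho>. complex_of_real ((SOME \<sigma>. \<sigma> \<in> ?E \<and> restrict \<sigma> S = \<rho>) y)) ` R"
        using \<sigma> unfolding R_def \<tau>_def by (intro image_eqI[of _ _ "restrict \<sigma> S"] imageI) auto
    qed
    then have cardZ: "card Z \<le> N" unfolding N_def using finR surj_card_le by blast
    have "degree p \<le> N" using cardZ \<open>degree ?p = card Z\<close> deg by simp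
    moreover have "\<bar>coeff p i\<bar> \<le> B" for i
    proof -
      have "norm (coeff ?p i) \<le> (1 + C') ^ card Z"
        unfolding prod
      proof (rule coeff_prod_linear_bound[OF finZ])
        fix z assume "z \<in> Z"
        then obtain \<sigma> where "\<sigma> \<in> ?E" "z = complex_of_real (\<sigma> y)" using emb by (auto simp: Z_def)
        then show "norm z \<le> C'" using y(3) by (force simp: C'_def)
      qed (simp add: C'_def)
      also have "\<dots> \<le> (1 + C') ^ N" using cardZ by (intro power_increasing) (simp_all add: C'_def)
      finally have "real_of_int \<bar>coeff p i\<bar> \<le> (1 + C') ^ N" by (simp add: coeff_map_poly)
      then show ?thesis unfolding B_def by linarith
    qed
    ultimately show ?thesis using p p0 by (auto simp: P_def)
  qed
  then have "{y \<in> determined_by S. algebraic_int y \<and> (\<forall>\<sigma>\<in>?E. \<bar>\<sigma> y\<bar> \<le> C)} \<subseteq>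
      (\<Union>p\<in>P - {0}. {w. poly (map_poly of_int p) w = 0})"
    by blast
  moreover have "finite (\<Union>p\<in>P - {0}. {w :: real. poly (map_poly of_int p) w = 0})"
    using finite_bounded_int_polys[of N B]
    by (intro finite_UN_I poly_roots_finite) (auto simp: P_def map_poly_eq_0_iff)
  ultimately show ?thesis by (rule finite_subset)
qed

section \<open>Field operations on \<open>determined_by S\<close>\<close>

lemma determined_byI:
  assumes "y \<in> K"
    and "\<And>\<sigma> \<tau>. \<sigma> \<in> real_embeddings K \<Longrightarrow> \<tau> \<in> real_embeddings K \<Longrightarrow> (\<And>s. s \<in> S \<Longrightarrow> \<sigma> s = \<tau> s) \<Longrightarrow> \<sigma> y = \<tau> y"
  shows "y \<in> determined_by S"
  using assms unfolding determined_by_def by blast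

lemma determined_by_K: "y \<in> determined_by S \<Longrightarrow> y \<in> K"
  by (simp add: determined_by_def)

lemma determined_byD:
  assumes "y \<in> determined_by S" "\<sigma> \<in> real_embeddings K" "\<tau> \<in> real_embeddings K"
    "\<And>s. s \<in> S \<Longrightarrow> \<sigma> s = \<tau> s"
  shows "\<sigma> y = \<tau> y"
  using assms unfolding determined_by_def by blast

lemma determined_by_add:
  assumes "x \<in> determined_by S" "y \<in> determined_by S"
  shows "x + y \<in> determined_by S"
proof (rule determined_byI)
  fix \<sigma> \<tau> assume e: "\<sigma> \<in> real_embeddings K" "\<tau> \<in> real_embeddings K" "\<And>s. s \<in> S \<Longrightarrow> \<sigma> s = \<tau> s"
  show "\<sigma> (x + y) = \<tau> (x + y)"
    using determined_byD[OF assms(1) e] determined_byD[OF assms(2) e] e(1,2) assms[THEN determined_by_K]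
    by (simp only: emb_add)
qed (intro K_add assms[THEN determined_by_K])

lemma determined_by_mult:
  assumes "x \<in> determined_by S" "y \<in> determined_by S"
  shows "x * y \<in> determined_by S"
proof (rule determined_byI)
  fix \<sigma> \<tau> assume e: "\<sigma> \<in> real_embeddings K" "\<tau> \<in> real_embeddings K" "\<And>s. s \<in> S \<Longrightarrow> \<sigma> s = \<tau> s"
  show "\<sigma> (x * y) = \<tau> (x * y)"
    using determined_byD[OF assms(1) e] determined_byD[OF assms(2) e] e(1,2) assms[THEN determined_by_K]
    by (simp only: emb_mult)
qed (intro K_mult assms[THEN determined_by_K])

lemma determined_by_inverse:
  assumes "x \<in> determined_by S"
  shows "inverse x \<in> determined_by S"
proof (rule determined_byI)
  fix \<sigma> \<tau> assume e: "\<sigma> \<in> real_embeddings K" "\<tau> \<in> real_embeddings K" "\<And>s. s \<in> S \<Longrightarrow> \<sigma> s = \<tau> s"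
  show "\<sigma> (inverse x) = \<tau> (inverse x)"
    using determined_byD[OF assms e] e(1,2) assms[THEN determined_by_K] by (simp only: emb_inverse)
qed (intro K_inverse assms[THEN determined_by_K])

lemma determined_by_of_int: "of_int n \<in> determined_by S"
  by (rule determined_byI) (simp_all only: emb_of_int K_of_int)

lemma determined_by_uminus: "x \<in> determined_by S \<Longrightarrow> - x \<in> determined_by S"
  using determined_by_mult[OF determined_by_of_int[of "-1"]] by simp

lemma determined_by_mem: "S \<subseteq> K \<Longrightarrow> s \<in> S \<Longrightarrow> s \<in> determined_by S"
  by (rule determined_byI) auto

section \<open>The ring of integers and its units\<close>

definition OK :: "real set" where "OK = {x \<in> K. algebraic_int x}"

lemma OK_K: "x \<in> OK \<Longrightarrow> x \<in> K" by (simp add: OK_def)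

lemma integers_of_sel [simp]:
  "carrier (integers_of K) = OK" "x \<oplus>\<^bsub>integers_of K\<^esub> y = x + y"
  "x \<otimes>\<^bsub>integers_of K\<^esub> y = x * y" "\<one>\<^bsub>integers_of K\<^esub> = 1" "\<zero>\<^bsub>integers_of K\<^esub> = 0"
  by (simp_all add: integers_of_def OK_def)

lemma OK_of_int: "of_int n \<in> OK"
  by (simp add: OK_def K_of_int int_imp_algebraic_int)

lemma OK_uminus: "x \<in> OK \<Longrightarrow> - x \<in> OK"
  by (auto simp: OK_def K_uminus)

lemma Units_integers_of_iff: "u \<in> Units (integers_of K) \<longleftrightarrow> u \<in> OK \<and> inverse u \<in> OK \<and> u \<noteq> 0"
proof
  assume "u \<in> Units (integers_of K)"
  then obtain w where w: "u \<in> OK" "w \<in> OK" "w * u = 1" by (auto simp: Units_def)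
  then have "inverse u = w" by (metis inverse_unique mult.commute)
  then show "u \<in> OK \<and> inverse u \<in> OK \<and> u \<noteq> 0" using w by auto
next
  assume "u \<in> OK \<and> inverse u \<in> OK \<and> u \<noteq> 0"
  then show "u \<in> Units (integers_of K)"
    by (auto simp: Units_def intro!: bexI[of _ "inverse u"])
qed

end

section \<open>Reflections of a positive definite lattice\<close>

locale pd_lattice = tr_field K for K +
  fixes L :: "(real, 'v, 'm) module_scheme" and Q :: "'v \<Rightarrow> real"
  assumes QL: "quadratic_lattice K L Q" and PD: "positive_definite K L Q"

sublocale pd_lattice \<subseteq> L: module "integers_of K" L
  using QL by (simp add: quadratic_lattice_def)

context pd_lattice
begin

abbreviation B where "B \<equiv> polar_form L Q"

section \<open>Integrality, bilinearity and definiteness of the form\<close>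

lemma OK_add: "x \<in> OK \<Longrightarrow> y \<in> OK \<Longrightarrow> x + y \<in> OK"
  and OK_mult: "x \<in> OK \<Longrightarrow> y \<in> OK \<Longrightarrow> x * y \<in> OK"
  using L.R.add.m_closed[of x y] L.R.m_closed[of x y] by simp_all

lemma OK_diff: "x \<in> OK \<Longrightarrow> y \<in> OK \<Longrightarrow> x - y \<in> OK"
  using OK_add[of x "- y"] OK_uminus by simp

lemma smult_mem: "a \<in> OK \<Longrightarrow> x \<in> carrier L \<Longrightarrow> a \<odot>\<^bsub>L\<^esub> x \<in> carrier L"
  using L.smult_closed by simp

lemma axpy_mem: "a \<in> OK \<Longrightarrow> x \<in> carrier L \<Longrightarrow> y \<in> carrier L \<Longrightarrow> x \<oplus>\<^bsub>L\<^esub> a \<odot>\<^bsub>L\<^esub> y \<in> carrier L"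
  using smult_mem by simp

lemma Q_OK: "x \<in> carrier L \<Longrightarrow> Q x \<in> OK"
  using QL by (auto simp: quadratic_lattice_def)

lemma Q_smult: "a \<in> OK \<Longrightarrow> x \<in> carrier L \<Longrightarrow> Q (a \<odot>\<^bsub>L\<^esub> x) = a\<^sup>2 * Q x"
  using QL by (auto simp: quadratic_lattice_def)

lemma B_add: "u \<in> carrier L \<Longrightarrow> v \<in> carrier L \<Longrightarrow> w \<in> carrier L \<Longrightarrow> B (u \<oplus>\<^bsub>L\<^esub> v) w = B u w + B v w"
  and B_smult: "a \<in> OK \<Longrightarrow> v \<in> carrier L \<Longrightarrow> w \<in> carrier L \<Longrightarrow> B (a \<odot>\<^bsub>L\<^esub> v) w = a * B v w"
  using QL by (auto simp: quadratic_lattice_def bilinear_form_def)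

lemma B_sym: "v \<in> carrier L \<Longrightarrow> w \<in> carrier L \<Longrightarrow> B v w = B w v"
  by (simp add: polar_form_def L.a_comm)

lemma B_axpy:
  "a \<in> OK \<Longrightarrow> x \<in> carrier L \<Longrightarrow> y \<in> carrier L \<Longrightarrow> w \<in> carrier L \<Longrightarrow>
    B (x \<oplus>\<^bsub>L\<^esub> a \<odot>\<^bsub>L\<^esub> y) w = B x w + a * B y w"
  by (simp add: B_add B_smult smult_mem)

lemma two_B_OK: "v \<in> carrier L \<Longrightarrow> w \<in> carrier L \<Longrightarrow> 2 * B v w \<in> OK"
  by (simp add: polar_form_def OK_diff Q_OK)

lemma B_K: "v \<in> carrier L \<Longrightarrow> w \<in> carrier L \<Longrightarrow> B v w \<in> K"
  using K_divide[OF OK_K[OF two_B_OK] K_of_int[of 2]] by simp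

lemma B_self: "x \<in> carrier L \<Longrightarrow> B x x = Q x"
proof -
  assume x: "x \<in> carrier L"
  have one: "1 \<in> OK" and two: "2 \<in> OK" using OK_of_int[of 1] OK_of_int[of 2] by simp_all
  have "2 \<odot>\<^bsub>L\<^esub> x = x \<oplus>\<^bsub>L\<^esub> x"
    using L.smult_l_distr[of 1 1 x] L.smult_one[OF x] one x by simp
  then have "Q (x \<oplus>\<^bsub>L\<^esub> x) = 4 * Q x" using Q_smult[OF two x] by simp
  then show ?thesis by (simp add: polar_form_def)
qed

lemma B_zero: "w \<in> carrier L \<Longrightarrow> B \<zero>\<^bsub>L\<^esub> w = 0"
  using B_add[of "\<zero>\<^bsub>L\<^esub>" "\<zero>\<^bsub>L\<^esub>" w] by simp

lemma Q_zero: "Q \<zero>\<^bsub>L\<^esub> = 0"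
  using B_self[of "\<zero>\<^bsub>L\<^esub>"] B_zero[of "\<zero>\<^bsub>L\<^esub>"] by simp

lemma Q_axpy:
  assumes "a \<in> OK" "x \<in> carrier L" "y \<in> carrier L"
  shows "Q (x \<oplus>\<^bsub>L\<^esub> a \<odot>\<^bsub>L\<^esub> y) = Q x + 2 * a * B x y + a\<^sup>2 * Q y"
proof -
  let ?w = "x \<oplus>\<^bsub>L\<^esub> a \<odot>\<^bsub>L\<^esub> y"
  have "Q ?w = B x ?w + a * B y ?w" using assms B_axpy axpy_mem B_self by metis
  also have "B x ?w = Q x + a * B x y"
    using assms B_axpy[of a x y x] B_sym[of x ?w] B_sym[of y x] axpy_mem B_self by simp
  also have "B y ?w = B x y + a * Q y"
    using assms B_axpy[of a x y y] B_sym[of y ?w] axpy_mem B_self by simp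
  finally show ?thesis by (simp add: algebra_simps power2_eq_square)
qed

lemma emb_Q_pos: "\<sigma> \<in> real_embeddings K \<Longrightarrow> x \<in> carrier L \<Longrightarrow> x \<noteq> \<zero>\<^bsub>L\<^esub> \<Longrightarrow> \<sigma> (Q x) > 0"
  using PD by (auto simp: positive_definite_def totally_positive_def)

lemma emb_Q_nonneg: "\<sigma> \<in> real_embeddings K \<Longrightarrow> x \<in> carrier L \<Longrightarrow> \<sigma> (Q x) \<ge> 0"
  using emb_Q_pos[of \<sigma> x] emb_0[of \<sigma>] Q_zero by fastforce

lemma Q_le_0D: "x \<in> carrier L \<Longrightarrow> Q x \<le> 0 \<Longrightarrow> x = \<zero>\<^bsub>L\<^esub>"
  using emb_Q_pos[OF id_embedding, of x] by force

text \<open>Here \<open>w\<close> is \<open>2 * Q y\<close> times the component of \<open>x\<close>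
  orthogonal to \<open>y\<close>, scaled so that its coefficients are integral; \<open>Q w\<close>
  is \<open>4 * Q y\<close> times the Gram determinant of \<open>x\<close> and
  \<open>y\<close>.\<close>

lemma
  assumes x: "x \<in> carrier L" and y: "y \<in> carrier L"
  defines "w \<equiv> (2 * Q y) \<odot>\<^bsub>L\<^esub> x \<oplus>\<^bsub>L\<^esub> (- (2 * B x y)) \<odot>\<^bsub>L\<^esub> y"
  shows gram_vector_mem: "w \<in> carrier L"
    and Q_gram_vector: "Q w = Q y * (4 * (Q x * Q y) - (2 * B x y)\<^sup>2)"
proof -
  have a: "2 * Q y \<in> OK" using OK_mult[OF OK_of_int[of 2] Q_OK[OF y]] by simp
  have b: "- (2 * B x y) \<in> OK" using OK_uminus[OF two_B_OK[OF x y]] .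
  have ax: "(2 * Q y) \<odot>\<^bsub>L\<^esub> x \<in> carrier L" using smult_mem[OF a x] .
  show "w \<in> carrier L" unfolding w_def by (rule axpy_mem[OF b ax y])
  show "Q w = Q y * (4 * (Q x * Q y) - (2 * B x y)\<^sup>2)"
    unfolding w_def Q_axpy[OF b ax y] Q_smult[OF a x] B_smult[OF a x y]
    by (simp add: algebra_simps power2_eq_square)
qed

text \<open>For nonzero \<open>y\<close>, apply \<open>\<sigma>\<close> to the nonnegative value of
  the Gram vector and divide by \<open>\<sigma> (Q y) > 0\<close>. Having this at every embedding
  bounds all conjugates of \<open>2 * B x y\<close>.\<close>

lemma emb_cauchy_schwarz:
  assumes \<sigma>: "\<sigma> \<in> real_embeddings K" and x: "x \<in> carrier L" and y: "y \<in> carrier L"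
  shows "(\<sigma> (2 * B x y))\<^sup>2 \<le> 4 * (\<sigma> (Q x) * \<sigma> (Q y))"
proof (cases "y = \<zero>\<^bsub>L\<^esub>")
  case True
  then show ?thesis using B_zero[OF x] B_sym[OF x y] emb_0[OF \<sigma>] Q_zero by simp
next
  case False
  let ?w = "(2 * Q y) \<odot>\<^bsub>L\<^esub> x \<oplus>\<^bsub>L\<^esub> (- (2 * B x y)) \<odot>\<^bsub>L\<^esub> y"
  note K = OK_K[OF Q_OK[OF x]] OK_K[OF Q_OK[OF y]] OK_K[OF two_B_OK[OF x y]]
  have four: "\<sigma> 4 = 4" "4 \<in> K" using emb_of_int[OF \<sigma>, of 4] K_of_int[of 4] by simp_all
  have "\<sigma> (Q ?w) \<ge> 0" using emb_Q_nonneg[OF \<sigma> gram_vector_mem[OF x y]] .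
  moreover have "\<sigma> (q * (4 * (p * q) - b\<^sup>2)) = \<sigma> q * (4 * (\<sigma> p * \<sigma> q) - (\<sigma> b)\<^sup>2)"
    if "p \<in> K" "q \<in> K" "b \<in> K" for p q b
    using \<sigma> that four by (simp add: emb_mult emb_diff K_mult K_diff power2_eq_square)
  ultimately have "0 \<le> \<sigma> (Q y) * (4 * (\<sigma> (Q x) * \<sigma> (Q y)) - (\<sigma> (2 * B x y))\<^sup>2)"
    unfolding Q_gram_vector[OF x y] using K by metis
  moreover have "\<sigma> (Q y) > 0" using emb_Q_pos[OF \<sigma> y False] .
  ultimately show ?thesis by (simp add: zero_le_mult_iff)
qed

text \<open>The Cauchy-Schwarz inequality at the inclusion of \<open>K\<close> into the reals
  supplies the opposite inequality.\<close>

lemma cauchy_schwarz_eq: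
  assumes x: "x \<in> carrier L" and y: "y \<in> carrier L" and le: "Q x * Q y \<le> (B x y)\<^sup>2"
  shows "(B x y)\<^sup>2 = Q x * Q y"
  using emb_cauchy_schwarz[OF id_embedding x y] le by (simp add: power_mult_distrib)

lemma eq_of_diff_zero:
  assumes "x \<in> carrier L" "y \<in> carrier L" "x \<oplus>\<^bsub>L\<^esub> (- 1) \<odot>\<^bsub>L\<^esub> y = \<zero>\<^bsub>L\<^esub>"
  shows "x = y"
proof -
  have one: "1 \<in> OK" "- 1 \<in> OK" using OK_of_int[of 1] OK_of_int[of "-1"] by simp_all
  have "(- 1) \<odot>\<^bsub>L\<^esub> y \<oplus>\<^bsub>L\<^esub> y = (-1 + 1) \<odot>\<^bsub>L\<^esub> y"
    using L.smult_l_distr[of "-1" 1 y] L.smult_one assms one by simp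
  also have "\<dots> = \<zero>\<^bsub>L\<^esub>" using L.smult_l_null[OF assms(2)] by simp
  finally have "y = \<ominus>\<^bsub>L\<^esub> ((- 1) \<odot>\<^bsub>L\<^esub> y)"
    using assms one smult_mem L.minus_equality L.a_comm by metis
  moreover have "x = \<ominus>\<^bsub>L\<^esub> ((- 1) \<odot>\<^bsub>L\<^esub> y)"
    using assms one smult_mem L.minus_equality L.a_comm by metis
  ultimately show ?thesis by simp
qed

lemma B_finsum:
  assumes "finite A" "\<And>i. i \<in> A \<Longrightarrow> f i \<in> carrier L" "w \<in> carrier L"
  shows "B (\<Oplus>\<^bsub>L\<^esub>i\<in>A. f i) w = (\<Sum>i\<in>A. B (f i) w)"
  using assms(1,2)
proof (induction A rule: finite_induct)
  case (insert i A)
  then have "(\<Oplus>\<^bsub>L\<^esub>i\<in>insert i A. f i) = f i \<oplus>\<^bsub>L\<^esub> (\<Oplus>\<^bsub>L\<^esub>i\<in>A. f i)"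
    by (intro L.finsum_insert) auto
  moreover have "(\<Oplus>\<^bsub>L\<^esub>i\<in>A. f i) \<in> carrier L" using insert by (intro L.finsum_closed) auto
  ultimately show ?case using insert assms(3) by (simp add: B_add)
qed (simp add: B_zero assms)

text \<open>One rule covers sums, multiples and reflections. The coefficients are the algebraic
  integers of the field determined by \<open>S\<close>.\<close>

inductive_set combos :: "(nat \<Rightarrow> 'v) \<Rightarrow> nat \<Rightarrow> real set \<Rightarrow> 'v set" for v k S where
  base: "i < k \<Longrightarrow> v i \<in> combos v k S"
| axpy: "x \<in> combos v k S \<Longrightarrow> y \<in> combos v k S \<Longrightarrow> a \<in> OK \<Longrightarrow> a \<in> determined_by S \<Longrightarrow>
    x \<oplus>\<^bsub>L\<^esub> a \<odot>\<^bsub>L\<^esub> y \<in> combos v k S"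

end

section \<open>Roots attached to a family of distinct unit classes\<close>

locale unit_family = pd_lattice K L Q
  for K and L :: "(real, 'v, 'm) module_scheme" and Q +
  fixes v :: "nat \<Rightarrow> 'v" and k :: nat
  assumes v_mem: "i < k \<Longrightarrow> v i \<in> carrier L"
    and v_unit: "i < k \<Longrightarrow> Q (v i) \<in> Units (integers_of K)"
    and v_classes: "i < k \<Longrightarrow> j < k \<Longrightarrow> i \<noteq> j \<Longrightarrow> e \<in> Units (integers_of K) \<Longrightarrow> Q (v i) \<noteq> e\<^sup>2 * Q (v j)"
begin

definition S where "S = (\<lambda>(i, j). B (v i) (v j)) ` ({..<k} \<times> {..<k})"

definition "V = combos v k S"

definition "roots i = {x \<in> V. Q x = Q (v i)}"

lemma finite_S: "finite S" by (simp add: S_def)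

lemma S_K: "S \<subseteq> K" using B_K v_mem by (auto simp: S_def)

lemma V_mem: "x \<in> V \<Longrightarrow> x \<in> carrier L"
  unfolding V_def by (induction rule: combos.induct) (auto simp: v_mem axpy_mem)

lemma V_axpy:
  "x \<in> V \<Longrightarrow> y \<in> V \<Longrightarrow> a \<in> OK \<Longrightarrow> a \<in> determined_by S \<Longrightarrow> x \<oplus>\<^bsub>L\<^esub> a \<odot>\<^bsub>L\<^esub> y \<in> V"
  unfolding V_def by (rule combos.axpy)

lemma V_induct [consumes 1, case_names base axpy]:
  assumes "x \<in> V" "\<And>i. i < k \<Longrightarrow> P (v i)"
    "\<And>x y a. x \<in> V \<Longrightarrow> y \<in> V \<Longrightarrow> P x \<Longrightarrow> P y \<Longrightarrow> a \<in> OK \<Longrightarrow> a \<in> determined_by S \<Longrightarrow>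
       P (x \<oplus>\<^bsub>L\<^esub> a \<odot>\<^bsub>L\<^esub> y)"
  shows "P x"
  using assms(1) unfolding V_def
proof (induction rule: combos.induct)
  case (base i)
  then show ?case by (rule assms(2))
next
  case (axpy x y a)
  then show ?case by (intro assms(3)) (simp_all add: V_def)
qed

lemma B_V_v: "x \<in> V \<Longrightarrow> j < k \<Longrightarrow> B x (v j) \<in> determined_by S"
proof (induction rule: V_induct)
  case (base i)
  then show ?case using determined_by_mem[OF S_K] by (auto simp: S_def)
next
  case (axpy x y a)
  then show ?case by (simp add: B_axpy V_mem v_mem determined_by_add determined_by_mult)
qed

text \<open>Coefficients and Gram entries are determined by \<open>S\<close>, hence so is
  \<open>B\<close> on \<open>V\<close>. This makes the coefficients of reflections admissible in
  \<open>combos\<close>.\<close>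

lemma B_V: "x \<in> V \<Longrightarrow> y \<in> V \<Longrightarrow> B y x \<in> determined_by S"
proof (induction rule: V_induct)
  case (base i)
  then show ?case using B_V_v by simp
next
  case (axpy x x' a)
  then have "B y (x \<oplus>\<^bsub>L\<^esub> a \<odot>\<^bsub>L\<^esub> x') = B y x + a * B y x'"
    using B_axpy[of a x x' y] B_sym[of y] V_mem axpy_mem by simp
  then show ?case using axpy by (simp add: determined_by_add determined_by_mult)
qed

lemma V_orthogonal:
  assumes "w \<in> carrier L" "\<And>j. j < k \<Longrightarrow> B w (v j) = 0" "x \<in> V"
  shows "B w x = 0"
  using assms(3)
proof (induction rule: V_induct)
  case (axpy x y a)
  then show ?case using B_axpy[of a x y w] B_sym[of w] V_mem axpy_mem assms(1) by simp
qed (simp add: assms)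

text \<open>The difference lies in \<open>V\<close> and is orthogonal to every \<open>v j\<close>,
  hence to itself, and definiteness makes it zero. So the numbers \<open>B x (v j)\<close> serve as
  coordinates on \<open>V\<close>.\<close>

lemma V_eqI:
  assumes x: "x \<in> V" "y \<in> V" "\<And>j. j < k \<Longrightarrow> B x (v j) = B y (v j)"
  shows "x = y"
proof -
  define w where "w = x \<oplus>\<^bsub>L\<^esub> (- 1) \<odot>\<^bsub>L\<^esub> y"
  have one: "- 1 \<in> OK" "- 1 \<in> determined_by S"
    using OK_of_int[of "-1"] determined_by_of_int[of "-1"] by simp_all
  have w: "w \<in> V" using V_axpy[OF x(1,2) one] by (simp add: w_def)
  have "B w (v j) = 0" if "j < k" for j
    using x V_mem v_mem that one by (simp add: w_def B_axpy)
  then have "Q w = 0" using V_orthogonal[OF V_mem[OF w] _ w] B_self[OF V_mem[OF w]] by simp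
  then have "w = \<zero>\<^bsub>L\<^esub>" using Q_le_0D[OF V_mem[OF w]] by simp
  then show ?thesis using eq_of_diff_zero V_mem x unfolding w_def by simp
qed

lemma unit_OK: "i < k \<Longrightarrow> Q (v i) \<in> OK" "i < k \<Longrightarrow> inverse (Q (v i)) \<in> OK" "i < k \<Longrightarrow> Q (v i) \<noteq> 0"
  using v_unit by (auto simp: Units_integers_of_iff)

lemma unit_pos: "i < k \<Longrightarrow> Q (v i) > 0"
  using unit_OK(3)[of i] Q_zero Q_le_0D[of "v i"] v_mem by fastforce

lemma roots_V: "x \<in> roots i \<Longrightarrow> x \<in> V" "x \<in> roots i \<Longrightarrow> Q x = Q (v i)"
  by (simp_all add: roots_def)

lemma v_roots: "i < k \<Longrightarrow> v i \<in> roots i"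
  by (auto simp: roots_def V_def combos.base)

text \<open>This is the reflection of \<open>x\<close> in \<open>y\<close>. Its coefficient is
  integral because \<open>2 * B x y\<close> is integral and \<open>Q (v j)\<close> is a
  unit.\<close>

lemma roots_axpy_mem:
  assumes "x \<in> roots i" "y \<in> roots j" "i < k" "j < k"
  defines "a \<equiv> - (2 * B x y * inverse (Q (v j)))"
  shows "a \<in> OK" "x \<oplus>\<^bsub>L\<^esub> a \<odot>\<^bsub>L\<^esub> y \<in> roots i"
proof -
  note xy = roots_V[OF assms(1)] roots_V[OF assms(2)]
  show a: "a \<in> OK"
    unfolding a_def using OK_uminus[OF OK_mult[OF two_B_OK unit_OK(2)]] xy V_mem assms by simp
  have "Q (v j) \<in> determined_by S"
    using B_V_v[OF roots_V(1)[OF v_roots[OF assms(4)]] assms(4)] B_self[OF v_mem[OF assms(4)]] by simp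
  then have "a \<in> determined_by S"
    unfolding a_def
    using determined_by_uminus[OF determined_by_mult[OF determined_by_mult[OF determined_by_of_int[of 2]
          B_V[OF xy(3,1)]] determined_by_inverse]] by simp
  then have "x \<oplus>\<^bsub>L\<^esub> a \<odot>\<^bsub>L\<^esub> y \<in> V" using V_axpy xy a by simp
  moreover have "Q (x \<oplus>\<^bsub>L\<^esub> a \<odot>\<^bsub>L\<^esub> y) = Q x + 2 * a * B x y + a\<^sup>2 * Q y"
    by (rule Q_axpy[OF a V_mem[OF xy(1)] V_mem[OF xy(3)]])
  then have "Q (x \<oplus>\<^bsub>L\<^esub> a \<odot>\<^bsub>L\<^esub> y) = Q (v i)"
    unfolding xy a_def using unit_OK(3)[OF assms(4)] by (simp add: power2_eq_square)
  ultimately show "x \<oplus>\<^bsub>L\<^esub> a \<odot>\<^bsub>L\<^esub> y \<in> roots i" by (simp add: roots_def)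
qed

text \<open>Reflecting a root in itself gives its negative, here in the form
  \<open>x + (-2) x\<close>.\<close>

lemma roots_uminus:
  assumes "x \<in> roots i" "i < k"
  shows "x \<oplus>\<^bsub>L\<^esub> (- 2) \<odot>\<^bsub>L\<^esub> x \<in> roots i"
proof -
  have "- (2 * B x x * inverse (Q (v i))) = - 2"
    using B_self V_mem roots_V[OF assms(1)] unit_OK(3)[OF assms(2)] by simp
  then show ?thesis using roots_axpy_mem(2)[OF assms(1,1,2,2)] by (simp only:)
qed

text \<open>By \<open>V_eqI\<close> a root is recovered from the tuple of the
  \<open>2 * B x (v j)\<close>, and each entry lies in a finite set by
  \<open>finite_bounded_integers\<close> and \<open>emb_cauchy_schwarz\<close>.\<close>

lemma finite_roots:
  assumes i: "i < k"
  shows "finite (roots i)"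
proof -
  have "\<exists>m. \<forall>\<sigma>\<in>real_embeddings K. \<bar>\<sigma> (Q (v j))\<bar> \<le> m" if j: "j < k" for j
  proof -
    have "finite (abs ` {\<sigma> (Q (v j)) |\<sigma>. \<sigma> \<in> real_embeddings K})"
      using finite_emb_values[OF OK_K[OF unit_OK(1)[OF j]]] by simp
    then show ?thesis
      by (intro exI[of _ "Max (abs ` {\<sigma> (Q (v j)) |\<sigma>. \<sigma> \<in> real_embeddings K})"]) (auto intro!: Max_ge)
  qed
  then obtain m where m: "\<bar>\<sigma> (Q (v j))\<bar> \<le> m j" if "j < k" "\<sigma> \<in> real_embeddings K" for j \<sigma>
    by metis
  define F where "F j = {y \<in> determined_by S. algebraic_int y \<and>
      (\<forall>\<sigma>\<in>real_embeddings K. \<bar>\<sigma> y\<bar> \<le> 4 * (m i * m j) + 1)}" for j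
  let ?f = "\<lambda>x. \<lambda>j\<in>{..<k}. 2 * B x (v j)"
  have "?f ` roots i \<subseteq> (\<Pi>\<^sub>E j\<in>{..<k}. F j)"
  proof (intro image_subsetI PiE_I)
    fix x j assume x: "x \<in> roots i" and "j \<in> {..<k}"
    then have j: "j < k" by simp
    have xL: "x \<in> carrier L" using V_mem roots_V[OF x] by simp
    have "2 * B x (v j) \<in> determined_by S"
      using determined_by_mult[OF determined_by_of_int[of 2] B_V_v[OF roots_V(1)[OF x] j]] by simp
    moreover have "algebraic_int (2 * B x (v j))" using two_B_OK[OF xL v_mem[OF j]] by (simp add: OK_def)
    moreover have "\<bar>\<sigma> (2 * B x (v j))\<bar> \<le> 4 * (m i * m j) + 1" if \<sigma>: "\<sigma> \<in> real_embeddings K" for \<sigma>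
    proof -
      have "(\<sigma> (2 * B x (v j)))\<^sup>2 \<le> 4 * (\<sigma> (Q (v i)) * \<sigma> (Q (v j)))"
        using emb_cauchy_schwarz[OF \<sigma> xL v_mem[OF j]] roots_V[OF x] by simp
      also have "\<sigma> (Q (v i)) * \<sigma> (Q (v j)) \<le> m i * m j"
        using m[OF i \<sigma>] m[OF j \<sigma>] by (metis abs_ge_self abs_ge_zero abs_mult mult_mono order_trans)
      finally have "(\<sigma> (2 * B x (v j)))\<^sup>2 \<le> 4 * (m i * m j)" by simp
      \<comment> \<open>This crude bound avoids a square root and accounts for the
        \<open>+ 1\<close> in \<open>F\<close>.\<close>
      moreover have "\<bar>r\<bar> \<le> r\<^sup>2 + 1" for r :: real
        using zero_le_power2[of "\<bar>r\<bar> - 1"] by (simp add: power2_diff)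
      from this[of "\<sigma> (2 * B x (v j))"] calculation show ?thesis by linarith
    qed
    ultimately show "?f x j \<in> F j" using j by (simp add: F_def)
  qed auto
  moreover have "finite (\<Pi>\<^sub>E j\<in>{..<k}. F j)"
    unfolding F_def by (intro finite_PiE finite_bounded_integers finite_S S_K) auto
  ultimately have "finite (?f ` roots i)" by (rule finite_subset)
  moreover have "inj_on ?f (roots i)"
  proof (rule inj_onI)
    fix x y assume xy: "x \<in> roots i" "y \<in> roots i" "?f x = ?f y"
    show "x = y"
    proof (rule V_eqI)
      fix j assume "j < k"
      then show "B x (v j) = B y (v j)" using fun_cong[OF xy(3), of j] by simp
    qed (use xy roots_V in auto)
  qed
  ultimately show ?thesis by (rule finite_imageD)
qed

end

section \<open>Heights and minimal roots\<close>

context unit_family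
begin

text \<open>Linear in \<open>x\<close> and polynomial in \<open>t\<close>, so that a functional
  nonzero on all roots is found by choosing a single real number.\<close>

definition "height t x = (\<Sum>j<k. B x (v j) * t ^ j)"

lemma height_axpy:
  "a \<in> OK \<Longrightarrow> x \<in> carrier L \<Longrightarrow> y \<in> carrier L \<Longrightarrow>
    height t (x \<oplus>\<^bsub>L\<^esub> a \<odot>\<^bsub>L\<^esub> y) = height t x + a * height t y"
  unfolding height_def
  by (simp add: B_axpy v_mem sum.distrib sum_distrib_left algebra_simps)

text \<open>The height polynomial of a root is nonzero, since otherwise the root would be orthogonal
  to \<open>V\<close> and so to itself. Take \<open>t\<close> outside the finitely many zeros of
  these finitely many polynomials.\<close>

lemma ex_generic_height: "\<exists>t. \<forall>i<k. \<forall>x\<in>roots i. height t x \<noteq> 0"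
proof -
  define P where "P x = (\<Sum>j<k. monom (B x (v j)) j)" for x
  have P: "poly (P x) t = height t x" for x t
    by (simp add: P_def height_def poly_sum poly_monom)
  have P_nz: "P x \<noteq> 0" if "x \<in> roots i" "i < k" for x i
  proof
    assume "P x = 0"
    then have "B x (v j) = 0" if "j < k" for j
    proof -
      have "coeff (P x) j = B x (v j)" using that by (simp add: P_def coeff_sum)
      then show ?thesis using \<open>P x = 0\<close> by simp
    qed
    then have "B x x = 0" using V_orthogonal that roots_V V_mem by blast
    then show False using B_self unit_pos that roots_V V_mem by (metis less_irrefl)
  qed
  have "finite (\<Union>i<k. \<Union>x\<in>roots i. {t. poly (P x) t = 0})"
    using P_nz finite_roots by (intro finite_UN_I poly_roots_finite) auto
  then obtain t where "t \<notin> (\<Union>i<k. \<Union>x\<in>roots i. {t. poly (P x) t = 0})"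
    using ex_new_if_finite[OF infinite_UNIV_char_0] by blast
  then show ?thesis unfolding P by blast
qed

text \<open>The minimal roots play the part of a simple system: if two of them formed an acute angle,
  reflecting either in the other would lower its height.\<close>

lemma ex_obtuse_system:
  "\<exists>t x. (\<forall>i<k. x i \<in> carrier L \<and> height t (x i) > 0) \<and>
         (\<forall>i<k. \<forall>j<k. i \<noteq> j \<longrightarrow> B (x i) (x j) \<le> 0)"
proof -
  obtain t where t: "height t x \<noteq> 0" if "i < k" "x \<in> roots i" for i x
    using ex_generic_height by blast
  have "\<exists>x\<in>roots i. height t x > 0 \<and> (\<forall>y\<in>roots i. height t x \<le> \<bar>height t y\<bar>)" if i: "i < k" for i
  proof -
    \<comment> \<open>Minimise the absolute height first; if the height found is negative, pass to
      the negative root.\<close>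
    obtain x where x: "x \<in> roots i" "\<And>y. y \<in> roots i \<Longrightarrow> \<bar>height t x\<bar> \<le> \<bar>height t y\<bar>"
      using finite_roots[OF i] v_roots[OF i] ex_min_if_finite[of "(\<lambda>x. \<bar>height t x\<bar>) ` roots i"]
      by (auto simp: not_less)
    define y where "y = x \<oplus>\<^bsub>L\<^esub> (- 2) \<odot>\<^bsub>L\<^esub> x"
    have y: "y \<in> roots i" using roots_uminus[OF x(1) i] by (simp add: y_def)
    have "height t y = - height t x"
      unfolding y_def using height_axpy[of "-2" x x t] OK_of_int[of "-2"] V_mem roots_V x(1) by simp
    moreover have "height t x \<noteq> 0" by (rule t[OF i x(1)])
    ultimately consider "height t x > 0" | "height t y > 0" by linarith
    then show ?thesis
    proof cases
      case 1
      then show ?thesis using x by (intro bexI[of _ x]) auto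
    next
      case 2
      then show ?thesis using x(2) y \<open>height t y = - height t x\<close> by (intro bexI[of _ y]) auto
    qed
  qed
  then have "\<forall>i. \<exists>x. i < k \<longrightarrow> x \<in> roots i \<and> height t x > 0 \<and> (\<forall>y\<in>roots i. height t x \<le> \<bar>height t y\<bar>)"
    by blast
  then obtain x where x: "\<And>i. i < k \<Longrightarrow> x i \<in> roots i" "\<And>i. i < k \<Longrightarrow> height t (x i) > 0"
    "\<And>i y. i < k \<Longrightarrow> y \<in> roots i \<Longrightarrow> height t (x i) \<le> \<bar>height t y\<bar>"
    by metis
  have xL: "x i \<in> carrier L" if "i < k" for i using x(1)[OF that] roots_V V_mem by blast
  have Qx: "Q (x i) = Q (v i)" if "i < k" for i using x(1)[OF that] roots_V by blast
  \<comment> \<open>The reflected root has height \<open>height t (x i) - c\<close> with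
    \<open>c > 0\<close>. Minimality forbids this to be nonnegative, so
    \<open>c - height t (x i)\<close> is at least \<open>height t (x i)\<close>; clearing
    \<open>Q (v j)\<close> gives the claim.\<close>
  have refl: "height t (x i) * Q (v j) \<le> B (x i) (x j) * height t (x j)"
    if ij: "i < k" "j < k" "B (x i) (x j) > 0" for i j
  proof -
    let ?a = "- (2 * B (x i) (x j) * inverse (Q (v j)))"
    let ?y = "x i \<oplus>\<^bsub>L\<^esub> ?a \<odot>\<^bsub>L\<^esub> x j"
    have a: "?a \<in> OK" "?y \<in> roots i" using roots_axpy_mem[OF x(1)[OF ij(1)] x(1)[OF ij(2)] ij(1,2)] .
    have h: "height t ?y = height t (x i) + ?a * height t (x j)"
      by (rule height_axpy[OF a(1) xL[OF ij(1)] xL[OF ij(2)]])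
    have "2 * B (x i) (x j) * inverse (Q (v j)) * height t (x j) > 0"
      using ij x(2)[OF ij(2)] unit_pos[OF ij(2)] by simp
    then have "height t (x i) \<le> B (x i) (x j) * inverse (Q (v j)) * height t (x j)"
      using x(3)[OF ij(1) a(2)] h by (simp add: abs_if split: if_splits)
    then show ?thesis using unit_pos[OF ij(2)] by (simp add: field_simps)
  qed
  have "B (x i) (x j) \<le> 0" if ij: "i < k" "j < k" "i \<noteq> j" for i j
  proof (rule ccontr)
    assume "\<not> B (x i) (x j) \<le> 0"
    then have pos: "B (x i) (x j) > 0" "B (x j) (x i) > 0" using B_sym xL ij by auto
    let ?b = "B (x i) (x j)" and ?hi = "height t (x i)" and ?hj = "height t (x j)"
    have hp: "?hi > 0" "?hj > 0" using x(2) ij by auto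
    have le: "?hi * Q (v j) \<le> ?b * ?hj" "?hj * Q (v i) \<le> ?b * ?hi"
      using refl[OF ij(1,2) pos(1)] refl[OF ij(2,1) pos(2)] B_sym[OF xL[OF ij(1)] xL[OF ij(2)]] by simp_all
    have "0 \<le> ?b * ?hj" "0 \<le> ?hj * Q (v i)" using pos hp unit_pos[OF ij(1)] by simp_all
    \<comment> \<open>In the product of the two inequalities both heights cancel, leaving
      Cauchy-Schwarz reversed.\<close>
    from mult_mono[OF le this]
    have "(?hi * ?hj) * (Q (v i) * Q (v j)) \<le> (?hi * ?hj) * ?b\<^sup>2"
      by (simp add: power2_eq_square algebra_simps)
    then have "Q (v i) * Q (v j) \<le> ?b\<^sup>2"
      using hp mult_le_cancel_left_pos[of "?hi * ?hj"] by simp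
    then have b2: "?b\<^sup>2 = Q (v i) * Q (v j)"
      using cauchy_schwarz_eq[OF xL[OF ij(1)] xL[OF ij(2)]] Qx ij by simp
    \<comment> \<open>Not only \<open>2 * ?b\<close> but \<open>?b\<close> itself is integral, being
      the positive square root of an algebraic integer.\<close>
    have "algebraic_int (?b\<^sup>2)"
      unfolding b2 using OK_mult[OF unit_OK(1)[OF ij(1)] unit_OK(1)[OF ij(2)]] by (simp add: OK_def)
    then have "algebraic_int (sqrt (?b\<^sup>2))" by (rule algebraic_int_sqrt)
    then have b: "?b \<in> OK" using pos B_K[OF xL[OF ij(1)] xL[OF ij(2)]] by (simp add: OK_def)
    \<comment> \<open>This is the unit whose square relates the two values. Its inverse is the same
      expression with the indices exchanged, as \<open>b2\<close> shows.\<close>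
    define e where "e = ?b * inverse (Q (v j))"
    have "inverse e = ?b * inverse (Q (v i))"
      using b2 pos unit_OK(3) ij by (simp add: e_def field_simps power2_eq_square)
    then have "e \<in> Units (integers_of K)"
      unfolding Units_integers_of_iff using OK_mult[OF b unit_OK(2)] ij pos unit_OK(3)[OF ij(2)]
      by (simp add: e_def)
    moreover have "Q (v i) = e\<^sup>2 * Q (v j)"
      unfolding e_def power_mult_distrib b2 using unit_OK(3)[OF ij(2)]
      by (simp add: field_simps power2_eq_square)
    ultimately show False using v_classes[OF ij] by blast
  qed
  then show ?thesis using x(2) xL by blast
qed

text \<open>Let \<open>z\<close> collect the terms with positive coefficients. The relation and
  obtuseness give \<open>Q z \<le> 0\<close>, so \<open>z = 0\<close>, yet \<open>z\<close> has
  positive height. Applied to \<open>a\<close> and to \<open>- a\<close>, this yields linear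
  independence.\<close>

lemma obtuse_independent:
  assumes x: "\<And>i. i < k \<Longrightarrow> x i \<in> carrier L" and h: "\<And>i. i < k \<Longrightarrow> height t (x i) > 0"
    and obtuse: "\<And>i j. i < k \<Longrightarrow> j < k \<Longrightarrow> i \<noteq> j \<Longrightarrow> B (x i) (x j) \<le> 0"
    and a: "\<And>i. i < k \<Longrightarrow> a i \<in> OK"
    and rel: "\<And>j. j < k \<Longrightarrow> (\<Sum>i<k. a i * B (x i) (x j)) = 0"
    and i: "i < k"
  shows "a i \<le> 0"
proof (rule ccontr)
  assume neg: "\<not> a i \<le> 0"
  define P where "P = {i. i < k \<and> a i > 0}"
  have finP: "finite P" and PK: "\<And>j. j \<in> P \<Longrightarrow> j < k" by (auto simp: P_def)
  have tm: "a j \<odot>\<^bsub>L\<^esub> x j \<in> carrier L" if "j \<in> P" for j using smult_mem a x PK that by simp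
  define z where "z = (\<Oplus>\<^bsub>L\<^esub>j\<in>P. a j \<odot>\<^bsub>L\<^esub> x j)"
  have z: "z \<in> carrier L" unfolding z_def using tm by (intro L.finsum_closed) auto
  have Bz: "B z w = (\<Sum>j\<in>P. a j * B (x j) w)" if "w \<in> carrier L" for w
    unfolding z_def using that tm PK a x by (simp add: B_finsum finP B_smult)
  \<comment> \<open>By the relation, \<open>B z (x j)\<close> is minus the sum over the indices
    outside \<open>P\<close>, where nonpositive coefficients multiply nonpositive values of
    \<open>B\<close>.\<close>
  have "B z (x j) \<le> 0" if j: "j \<in> P" for j
  proof -
    have "(\<Sum>i<k. a i * B (x i) (x j)) = (\<Sum>i\<in>P. a i * B (x i) (x j)) + (\<Sum>i\<in>{..<k} - P. a i * B (x i) (x j))"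
      using PK by (subst add.commute, intro sum.subset_diff) auto
    moreover have "(\<Sum>i\<in>{..<k} - P. a i * B (x i) (x j)) \<ge> 0"
    proof (intro sum_nonneg)
      fix i assume "i \<in> {..<k} - P"
      then have "i < k" "a i \<le> 0" "i \<noteq> j" using j by (auto simp: P_def)
      then show "0 \<le> a i * B (x i) (x j)" using obtuse PK j by (intro mult_nonpos_nonpos) auto
    qed
    ultimately show ?thesis using Bz[OF x[OF PK[OF j]]] rel[OF PK[OF j]] by simp
  qed
  then have "(\<Sum>j\<in>P. a j * B z (x j)) \<le> 0"
    by (intro sum_nonpos) (auto simp: P_def mult_le_0_iff)
  moreover have "B z z = (\<Sum>j\<in>P. a j * B z (x j))"
    using Bz[OF z] B_sym z x PK by simp
  ultimately have "z = \<zero>\<^bsub>L\<^esub>" using B_self[OF z] Q_le_0D[OF z] by simp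
  then have "height t z = 0" by (simp add: height_def B_zero v_mem)
  moreover have "height t z = (\<Sum>j\<in>P. a j * height t (x j))"
    unfolding height_def
    by (simp add: Bz v_mem sum_distrib_left sum_distrib_right mult.assoc sum.swap[of _ P])
  moreover have "(\<Sum>j\<in>P. a j * height t (x j)) > 0"
  proof (intro sum_pos finP)
    have "i \<in> P" using neg i by (simp add: P_def)
    then show "P \<noteq> {}" by blast
    show "0 < a j * height t (x j)" if "j \<in> P" for j
      using that h[of j] by (simp add: P_def)
  qed
  ultimately show False by simp
qed

end

section \<open>The rank of the lattice\<close>

text \<open>The multiplier is the leading coefficient of an integer polynomial that annihilates
  \<open>y\<close>.\<close>

lemma ex_int_mult_algebraic_int:
  fixes y :: "'a :: field_char_0"
  assumes "algebraic y"
  shows "\<exists>m :: int. m \<noteq> 0 \<and> algebraic_int (of_int m * y)"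
proof -
  obtain p :: "int poly" where p: "p \<noteq> 0" "poly (map_poly of_int p) y = 0"
    using assms by (elim algebraicE')
  define m where "m = lead_coeff p"
  define n where "n = degree p"
  have m: "m \<noteq> 0" using p(1) by (simp add: m_def)
  have n: "n \<noteq> 0"
  proof
    assume "n = 0"
    then obtain c where "p = [:c:]" unfolding n_def by (rule degree_eq_zeroE)
    then show False using p by (simp add: map_poly_pCons)
  qed
  have deg: "degree (map_poly of_int p :: 'a poly) = n" by (simp add: degree_map_poly n_def)
  \<comment> \<open>This is \<open>m ^ (n - 1)\<close> times \<open>p\<close> evaluated at
    \<open>X / m\<close>: it is monic, and its coefficients are integers.\<close>
  define q :: "'a poly" where "q = monom 1 n + (\<Sum>i<n. monom (of_int (coeff p i * m ^ (n - 1 - i))) i)"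
  have co: "coeff q i = (if i = n then 1 else if i < n then of_int (coeff p i * m ^ (n - 1 - i)) else 0)" for i
    by (simp add: q_def coeff_sum)
  have "degree q \<le> n" by (rule degree_le) (simp add: co)
  moreover have "coeff q n = 1" by (simp add: co)
  ultimately have dq: "degree q = n" using le_degree[of q n] by simp
  have "poly q (of_int m * y) = (of_int m * y) ^ n + (\<Sum>i<n. of_int (coeff p i) * of_int m ^ (n - 1 - i) * (of_int m * y) ^ i)"
    by (simp add: q_def poly_sum poly_monom)
  also have "(\<Sum>i<n. of_int (coeff p i) * of_int m ^ (n - 1 - i) * (of_int m * y) ^ i) =
      (\<Sum>i<n. of_int m ^ (n - 1) * (of_int (coeff p i) * y ^ i))"
  proof (rule sum.cong)
    fix i assume "i \<in> {..<n}"
    then have "(of_int m :: 'a) ^ (n - 1) = of_int m ^ (n - 1 - i) * of_int m ^ i"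
      by (simp flip: power_add)
    then show "of_int (coeff p i) * of_int m ^ (n - 1 - i) * (of_int m * y) ^ i =
      of_int m ^ (n - 1) * (of_int (coeff p i) * y ^ i)"
      by (simp add: power_mult_distrib)
  qed simp
  also have "(of_int m * y) ^ n = of_int m ^ (n - 1) * (of_int (coeff p n) * y ^ n)"
    using n by (cases n) (simp_all add: m_def n_def power_mult_distrib)
  also have "of_int m ^ (n - 1) * (of_int (coeff p n) * y ^ n) +
      (\<Sum>i<n. of_int m ^ (n - 1) * (of_int (coeff p i) * y ^ i)) =
      of_int m ^ (n - 1) * (\<Sum>i\<le>n. of_int (coeff p i) * y ^ i)"
    by (simp add: sum_distrib_left lessThan_Suc_atMost[symmetric] distrib_left)
  also have "(\<Sum>i\<le>n. of_int (coeff p i) * y ^ i) = poly (map_poly of_int p) y"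
    by (simp add: poly_altdef deg coeff_map_poly)
  finally have "poly q (of_int m * y) = 0" using p(2) by simp
  then have "algebraic_int (of_int m * y)"
    by (intro algebraic_int.intros[of q]) (auto simp: dq co)
  then show ?thesis using m by blast
qed

context pd_lattice
begin

lemma ex_common_denominator:
  fixes c :: "nat \<Rightarrow> real"
  assumes "\<And>i. i < n \<Longrightarrow> c i \<in> K"
  shows "\<exists>m :: int. m \<noteq> 0 \<and> (\<forall>i<n. of_int m * c i \<in> OK)"
  using assms
proof (induction n)
  case 0
  show ?case by (intro exI[of _ 1]) simp
next
  case (Suc n)
  then obtain m :: int where m: "m \<noteq> 0" "\<forall>i<n. of_int m * c i \<in> OK" by force
  obtain l :: int where l: "l \<noteq> 0" "algebraic_int (of_int l * c n)"
    using ex_int_mult_algebraic_int K_algebraic Suc.prems by blast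
  then have lO: "of_int l * c n \<in> OK" using Suc.prems by (simp add: OK_def K_mult K_of_int)
  have "of_int (m * l) * c i \<in> OK" if "i < Suc n" for i
  proof (cases "i = n")
    case True
    then show ?thesis using OK_mult[OF OK_of_int lO, of m] by (simp add: mult.assoc)
  next
    case False
    then have "of_int m * c i \<in> OK" using m that by simp
    then show ?thesis using OK_mult[OF OK_of_int, of _ l] by (simp add: mult.assoc mult.left_commute)
  qed
  then show ?case using m l by (intro exI[of _ "m * l"]) auto
qed

section \<open>Functionals on the base change\<close>

abbreviation F where "F \<equiv> free_Abelian_group (carrier L \<times> K)"
abbreviation N where "N \<equiv> tensor_kernel K L"
abbreviation T where "T \<equiv> tensor_field K L"

text \<open>The additive extension of \<open>(v, c) \<mapsto> c * B v w\<close> to the free abelian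
  group, prior to passing to the tensor product.\<close>

definition pairing :: "'v \<Rightarrow> (('v \<times> real) \<Rightarrow>\<^sub>0 int) \<Rightarrow> real" where
  "pairing w x = (\<Sum>p\<in>Poly_Mapping.keys x. of_int (Poly_Mapping.lookup x p) * (snd p * B (fst p) w))"

lemma pairing_superset:
  "finite A \<Longrightarrow> Poly_Mapping.keys x \<subseteq> A \<Longrightarrow>
    pairing w x = (\<Sum>p\<in>A. of_int (Poly_Mapping.lookup x p) * (snd p * B (fst p) w))"
  unfolding pairing_def by (intro sum.mono_neutral_left) (auto simp: in_keys_iff)

lemma pairing_diff: "pairing w (x - y) = pairing w x - pairing w y"
proof -
  let ?A = "Poly_Mapping.keys x \<union> Poly_Mapping.keys y"
  have "pairing w z = (\<Sum>p\<in>?A. of_int (Poly_Mapping.lookup z p) * (snd p * B (fst p) w))"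
    if "Poly_Mapping.keys z \<subseteq> ?A" for z
    by (rule pairing_superset) (simp_all add: that)
  from this[of x] this[of y] this[of "x - y"] show ?thesis
    by (simp add: keys_diff lookup_minus algebra_simps sum_subtractf)
qed

lemma pairing_zero: "pairing w 0 = 0"
  by (simp add: pairing_def)

lemma pairing_uminus: "pairing w (- x) = - pairing w x"
  using pairing_diff[of w 0 x] by (simp add: pairing_zero)

lemma pairing_add: "pairing w (x + y) = pairing w x + pairing w y"
  using pairing_diff[of w x "- y"] by (simp add: pairing_uminus)

lemma pairing_frag_of: "pairing w (frag_of (v, c)) = c * B v w"
  by (simp add: pairing_def)

lemma pairing_scale:
  "pairing w (frag_extend (\<lambda>(v, c). frag_of (v, d * c)) x) = d * pairing w x"
  by (rule frag_induction[of x UNIV])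
     (auto simp: pairing_zero pairing_diff pairing_frag_of frag_extend_diff right_diff_distrib)

lemma L_module: "module (integers_of K) L" ..

lemma relations_F: "tensor_relations K L \<subseteq> carrier F"
  by (rule tensor_relations_subset[OF K L_module])

lemma group_F: "comm_group F" by (rule abelian_free_Abelian_group)

lemma subgroup_N: "subgroup N F"
  unfolding tensor_kernel_def
  by (rule group.generate_is_subgroup[OF comm_group.axioms(2)[OF group_F] relations_F])

text \<open>Bilinearity of \<open>B\<close> annihilates each defining relation of the tensor
  product, so the functional descends to cosets.\<close>

lemma pairing_N:
  assumes "x \<in> N" and w: "w \<in> carrier L"
  shows "pairing w x = 0"
proof -
  have rel: "pairing w h = 0" if "h \<in> tensor_relations K L" for h
    using that w unfolding tensor_relations_def
    by (auto simp: pairing_diff pairing_frag_of B_add B_smult distrib_left distrib_right)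
  show ?thesis
    using assms(1) unfolding tensor_kernel_def
  proof (induction rule: generate.induct)
    case one
    show ?case by (simp add: pairing_zero)
  next
    case (incl h)
    then show ?case by (rule rel)
  next
    case (inv h)
    then have "h \<in> carrier F" using relations_F by blast
    then show ?case using rel[OF inv] by (simp add: pairing_uminus)
  next
    case (eng h1 h2)
    then show ?case by (simp add: pairing_add)
  qed
qed

end

sublocale pd_lattice \<subseteq> T: vectorspace "real_subring K" "tensor_field K L"
  by (rule vectorspace_tensor_field[OF K L_module])

context pd_lattice
begin

section \<open>The base change as a space of cosets\<close>

lemma T_carrier: "carrier T = rcosets\<^bsub>F\<^esub> N" and T_zero: "\<zero>\<^bsub>T\<^esub> = N"
  and T_add: "C \<oplus>\<^bsub>T\<^esub> D = C <#>\<^bsub>F\<^esub> D"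
  and T_smult: "d \<odot>\<^bsub>T\<^esub> C = (\<Union>x\<in>C. N #>\<^bsub>F\<^esub> frag_extend (\<lambda>(v, c). frag_of (v, d * c)) x)"
  by (simp_all add: tensor_field_def Let_def)

lemma coset_T: "x \<in> carrier F \<Longrightarrow> N #>\<^bsub>F\<^esub> x \<in> carrier T"
  by (auto simp: T_carrier RCOSETS_def)

lemma mem_coset: "z \<in> N #>\<^bsub>F\<^esub> x \<longleftrightarrow> z - x \<in> N"
proof -
  have "z \<in> N #>\<^bsub>F\<^esub> x \<longleftrightarrow> (\<exists>n\<in>N. z = n + x)" by (auto simp: r_coset_def)
  then show ?thesis by (auto intro!: bexI[of _ "z - x"])
qed

lemma zero_N: "0 \<in> N"
  using subgroup.one_closed[OF subgroup_N] by simp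

lemma coset_self: "x \<in> N #>\<^bsub>F\<^esub> x"
  by (simp add: mem_coset zero_N)

lemma T_cases:
  assumes "C \<in> carrier T"
  obtains x where "x \<in> carrier F" "C = N #>\<^bsub>F\<^esub> x"
  using assms by (auto simp: T_carrier RCOSETS_def)

lemma coset_eqI: "C \<in> carrier T \<Longrightarrow> x \<in> C \<Longrightarrow> C = N #>\<^bsub>F\<^esub> x"
  using group.repr_independence[OF comm_group.axioms(2)[OF group_F] _ _ subgroup_N]
  by (elim T_cases) auto

text \<open>The representative is an arbitrary choice; \<open>eval_T_eq\<close> shows that the value
  does not depend on it.\<close>

definition eval_T :: "'v \<Rightarrow> (('v \<times> real) \<Rightarrow>\<^sub>0 int) set \<Rightarrow> real" where
  "eval_T w C = pairing w (SOME x. x \<in> C)"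

lemma eval_T_eq:
  assumes C: "C \<in> carrier T" and x: "x \<in> C" and w: "w \<in> carrier L"
  shows "eval_T w C = pairing w x"
proof -
  define z where "z = (SOME x. x \<in> C)"
  have "z \<in> C" unfolding z_def using x by (rule someI)
  then have "z - x \<in> N" using coset_eqI[OF C x] mem_coset by simp
  then have "pairing w (z - x) = 0" using w by (rule pairing_N)
  then show ?thesis unfolding eval_T_def z_def[symmetric] by (simp add: pairing_diff)
qed

lemma T_nonempty: "C \<in> carrier T \<Longrightarrow> \<exists>x. x \<in> C"
  using coset_self by (elim T_cases) blast

lemma add_mem_T: "x \<in> C \<Longrightarrow> y \<in> D \<Longrightarrow> x + y \<in> C \<oplus>\<^bsub>T\<^esub> D"
  by (force simp: T_add set_mult_def)

lemma scale_mem_T: "x \<in> C \<Longrightarrow> frag_extend (\<lambda>(v, c). frag_of (v, d * c)) x \<in> d \<odot>\<^bsub>T\<^esub> C"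
  unfolding T_smult using coset_self by blast

lemma eval_T_add:
  assumes "C \<in> carrier T" "D \<in> carrier T" "w \<in> carrier L"
  shows "eval_T w (C \<oplus>\<^bsub>T\<^esub> D) = eval_T w C + eval_T w D"
proof -
  obtain x y where xy: "x \<in> C" "y \<in> D" using T_nonempty assms by blast
  have "C \<oplus>\<^bsub>T\<^esub> D \<in> carrier T" using assms by simp
  from eval_T_eq[OF this add_mem_T[OF xy] assms(3)] show ?thesis
    using eval_T_eq[OF assms(1) xy(1) assms(3)] eval_T_eq[OF assms(2) xy(2) assms(3)]
    by (simp add: pairing_add)
qed

lemma eval_T_smult:
  assumes "C \<in> carrier T" "d \<in> K" "w \<in> carrier L"
  shows "eval_T w (d \<odot>\<^bsub>T\<^esub> C) = d * eval_T w C"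
proof -
  obtain x where x: "x \<in> C" using T_nonempty assms by blast
  have "d \<odot>\<^bsub>T\<^esub> C \<in> carrier T" using assms T.smult_closed by simp
  from eval_T_eq[OF this scale_mem_T[OF x] assms(3)] show ?thesis
    using eval_T_eq[OF assms(1) x assms(3)] by (simp add: pairing_scale)
qed

lemma eval_T_zero: "w \<in> carrier L \<Longrightarrow> eval_T w \<zero>\<^bsub>T\<^esub> = 0"
  using eval_T_add[of "\<zero>\<^bsub>T\<^esub>" "\<zero>\<^bsub>T\<^esub>" w] by simp

lemma eval_T_lincomb:
  assumes "finite A" "A \<subseteq> carrier T" "a \<in> A \<rightarrow> K" "w \<in> carrier L"
  shows "eval_T w (T.lincomb a A) = (\<Sum>C\<in>A. a C * eval_T w C)"
  using assms(1-3)
proof (induction A rule: finite_induct)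
  case empty
  then show ?case by (simp add: T.lincomb_def eval_T_zero assms)
next
  case (insert C A)
  have "T.lincomb a (insert C A) = a C \<odot>\<^bsub>T\<^esub> C \<oplus>\<^bsub>T\<^esub> T.lincomb a A"
    unfolding T.lincomb_def using insert by (intro T.finsum_insert) (auto intro!: T.smult_closed)
  moreover have "T.lincomb a A \<in> carrier T" using insert by (intro T.lincomb_closed) auto
  moreover have "a C \<odot>\<^bsub>T\<^esub> C \<in> carrier T" using insert by (intro T.smult_closed) auto
  ultimately show ?case using insert assms(4) by (simp add: eval_T_add eval_T_smult)
qed

text \<open>The pure tensor \<open>u \<otimes> c\<close>.\<close>

definition tens :: "'v \<Rightarrow> real \<Rightarrow> (('v \<times> real) \<Rightarrow>\<^sub>0 int) set" where
  "tens u c = N #>\<^bsub>F\<^esub> frag_of (u, c)"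

lemma frag_of_F: "u \<in> carrier L \<Longrightarrow> c \<in> K \<Longrightarrow> frag_of (u, c) \<in> carrier F"
  by (auto simp: free_Abelian_group_def)

lemma tens_T: "u \<in> carrier L \<Longrightarrow> c \<in> K \<Longrightarrow> tens u c \<in> carrier T"
  unfolding tens_def by (intro coset_T frag_of_F)

lemma eval_T_tens: "u \<in> carrier L \<Longrightarrow> c \<in> K \<Longrightarrow> w \<in> carrier L \<Longrightarrow> eval_T w (tens u c) = c * B u w"
  using eval_T_eq[OF tens_T coset_self[of "frag_of (u, c)", folded tens_def]] by (simp add: pairing_frag_of)

lemma tens_smult: "u \<in> carrier L \<Longrightarrow> c \<in> K \<Longrightarrow> d \<in> K \<Longrightarrow> d \<odot>\<^bsub>T\<^esub> tens u c = tens u (d * c)"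
  using coset_eqI[OF T.smult_closed scale_mem_T[OF coset_self[of "frag_of (u, c)", folded tens_def], of d]] tens_T
  by (simp add: tens_def)

lemma relation_N: "r \<in> tensor_relations K L \<Longrightarrow> r \<in> N"
  unfolding tensor_kernel_def by (rule generate.incl)

lemma tens_add_left:
  assumes "u \<in> carrier L" "u' \<in> carrier L" "c \<in> K"
  shows "tens (u \<oplus>\<^bsub>L\<^esub> u') c = tens u c \<oplus>\<^bsub>T\<^esub> tens u' c"
proof -
  have "frag_of (u, c) + frag_of (u', c) \<in> tens u c \<oplus>\<^bsub>T\<^esub> tens u' c"
    unfolding tens_def by (intro add_mem_T coset_self)
  then have eq: "tens u c \<oplus>\<^bsub>T\<^esub> tens u' c = N #>\<^bsub>F\<^esub> (frag_of (u, c) + frag_of (u', c))"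
    using assms by (intro coset_eqI) (simp_all add: tens_T)
  have "frag_of (u \<oplus>\<^bsub>L\<^esub> u', c) - frag_of (u, c) - frag_of (u', c) \<in> tensor_relations K L"
    unfolding tensor_relations_def using assms by blast
  then have "frag_of (u \<oplus>\<^bsub>L\<^esub> u', c) \<in> tens u c \<oplus>\<^bsub>T\<^esub> tens u' c"
    using relation_N unfolding eq mem_coset by (simp add: diff_diff_eq)
  then show ?thesis unfolding tens_def[of "u \<oplus>\<^bsub>L\<^esub> u'"] using assms
    by (intro coset_eqI[symmetric]) (simp_all add: tens_T)
qed

lemma tens_smult_left:
  assumes "u \<in> carrier L" "a \<in> OK" "c \<in> K"
  shows "tens (a \<odot>\<^bsub>L\<^esub> u) c = tens u (a * c)"
proof -
  have "frag_of (a \<odot>\<^bsub>L\<^esub> u, c) - frag_of (u, a * c) \<in> tensor_relations K L"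
    unfolding tensor_relations_def using assms by auto
  then have "frag_of (a \<odot>\<^bsub>L\<^esub> u, c) \<in> tens u (a * c)"
    unfolding tens_def mem_coset by (rule relation_N)
  then show ?thesis unfolding tens_def[of "a \<odot>\<^bsub>L\<^esub> u"] using assms
    by (intro coset_eqI[symmetric]) (simp_all add: tens_T K_mult OK_K)
qed

text \<open>The tensors \<open>g \<otimes> 1\<close>, for \<open>g\<close> in a finite generating
  set of the lattice, span. Finite dimension is needed for \<open>T.dim\<close> to bound the size of
  independent sets.\<close>

lemma fin_dim_T: "T.fin_dim"
proof -
  obtain G where G: "finite G" "G \<subseteq> carrier L" "L.span G = carrier L"
    using QL by (auto simp: quadratic_lattice_def)
  define A where "A = (\<lambda>g. tens g 1) ` G"
  have A: "finite A" "A \<subseteq> carrier T" using G tens_T K_1 by (auto simp: A_def)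
  define W where "W = T.span A"
  have sub: "submodule (real_subring K) W T" unfolding W_def by (rule T.span_is_submodule[OF A(2)])
  have W_add: "C \<oplus>\<^bsub>T\<^esub> D \<in> W" if "C \<in> W" "D \<in> W" for C D
    using submodule.m_closed[OF sub] that by simp
  have W_smult: "d \<odot>\<^bsub>T\<^esub> C \<in> W" if "d \<in> K" "C \<in> W" for C d
    using submodule.smult_closed[OF sub] that by simp
  have W_T: "C \<in> carrier T" if "C \<in> W" for C
    using submodule.subset[OF sub] that by blast
  \<comment> \<open>A submodule of \<open>L\<close> containing the generators, hence everything; so
    all \<open>u \<otimes> 1\<close> lie in \<open>W\<close>.\<close>
  define M where "M = {u \<in> carrier L. tens u 1 \<in> W}"
  have "submodule (integers_of K) M L"
  proof (unfold_locales, goal_cases)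
    case 1 show ?case by (auto simp: M_def)
  next
    case (2 u u')
    then show ?case using W_add tens_add_left K_1 by (simp add: M_def)
  next
    case 3
    have "\<zero>\<^bsub>T\<^esub> \<in> W" using submodule.zero_closed[OF sub] by simp
    moreover have "tens \<zero>\<^bsub>L\<^esub> 1 = \<zero>\<^bsub>T\<^esub>"
      using tens_add_left[of "\<zero>\<^bsub>L\<^esub>" "\<zero>\<^bsub>L\<^esub>" 1] tens_T[of "\<zero>\<^bsub>L\<^esub>" 1] K_1 by simp
    ultimately show ?case by (simp add: M_def)
  next
    case (4 a u)
    then have a: "a \<in> OK" and u: "u \<in> carrier L" "tens u 1 \<in> W" by (simp_all add: M_def)
    have "tens (a \<odot>\<^bsub>L\<^esub> u) 1 = a \<odot>\<^bsub>T\<^esub> tens u 1"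
      using tens_smult_left[OF u(1) a K_1] tens_smult[OF u(1) K_1 OK_K[OF a]] by simp
    then show ?case using W_smult[OF OK_K[OF a] u(2)] smult_mem[OF a u(1)] by (simp add: M_def)
  qed
  moreover have "G \<subseteq> M" using G(2) T.in_own_span[OF A(2)] by (auto simp: M_def W_def A_def)
  ultimately have "carrier L \<subseteq> M" using L.span_is_subset G(3) by blast
  then have tW: "tens u c \<in> W" if "u \<in> carrier L" "c \<in> K" for u c
    using W_smult[of c "tens u 1"] tens_smult[OF that(1) K_1 that(2)] that by (auto simp: M_def)
  \<comment> \<open>Every element of the free abelian group arises from generators by subtraction,
    so pure tensors suffice.\<close>
  have "N #>\<^bsub>F\<^esub> x \<in> W" if "x \<in> carrier F" for x
  proof -
    have "Poly_Mapping.keys x \<subseteq> carrier L \<times> K" using that by (simp add: free_Abelian_group_def)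
    then have "x \<in> carrier F \<and> N #>\<^bsub>F\<^esub> x \<in> W"
    proof (induction rule: frag_induction)
      case zero
      have "N #>\<^bsub>F\<^esub> 0 = \<zero>\<^bsub>T\<^esub>" 
        using coset_eqI[OF T.zero_closed, of 0] zero_N by (simp add: T_zero)
      then show ?case using submodule.zero_closed[OF sub] by (simp add: free_Abelian_group_def)
    next
      case (one p)
      then show ?case using tW[of "fst p" "snd p"] frag_of_F[of "fst p" "snd p"] by (auto simp: tens_def)
    next
      case (diff x y)
      have xy: "x - y \<in> carrier F"
        using diff keys_diff[of x y] by (auto simp: free_Abelian_group_def)
      let ?D = "N #>\<^bsub>F\<^esub> (x - y)" and ?X = "N #>\<^bsub>F\<^esub> x" and ?Y = "N #>\<^bsub>F\<^esub> y"
      have D: "?D \<in> carrier T" "?X \<in> carrier T" "?Y \<in> carrier T" using coset_T xy diff by auto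
      have "(x - y) + y \<in> ?D \<oplus>\<^bsub>T\<^esub> ?Y" by (intro add_mem_T coset_self)
      then have "?D \<oplus>\<^bsub>T\<^esub> ?Y = ?X" using coset_eqI[of "?D \<oplus>\<^bsub>T\<^esub> ?Y" x] D by simp
      then have "?D = ?X \<oplus>\<^bsub>T\<^esub> \<ominus>\<^bsub>T\<^esub> ?Y"
        using D by (metis T.a_assoc T.add.inv_closed T.r_neg T.r_zero)
      moreover have "\<ominus>\<^bsub>T\<^esub> ?Y = (- 1) \<odot>\<^bsub>T\<^esub> ?Y"
      proof -
        have m1: "- 1 \<in> K" using K_of_int[of "-1"] by simp
        have "(- 1) \<odot>\<^bsub>T\<^esub> ?Y \<oplus>\<^bsub>T\<^esub> ?Y = (-1 + 1) \<odot>\<^bsub>T\<^esub> ?Y"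
          using T.smult_l_distr[of "-1" 1 ?Y] T.smult_one[OF D(3)] m1 K_1 D by simp
        also have "\<dots> = \<zero>\<^bsub>T\<^esub>" using T.smult_l_null[OF D(3)] by simp
        finally show ?thesis using T.minus_equality[OF _ D(3)] T.smult_closed m1 D by simp
      qed
      ultimately show ?case using W_add W_smult[of "-1" ?Y] K_of_int[of "-1"] diff xy by simp
    qed
    then show ?thesis by blast
  qed
  then have "carrier T \<subseteq> W" by (auto elim!: T_cases)
  then have "T.span A = carrier T" using W_T by (auto simp: W_def)
  then show ?thesis using A by (auto simp: T.fin_dim_def)
qed

text \<open>The functionals \<open>eval_T (x j)\<close> turn a relation among the tensors
  \<open>x i \<otimes> 1\<close> into one among the rows of the Gram matrix. Clearing denominators
  moves it from \<open>K\<close> to the integers, where \<open>ind\<close> applies.\<close>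

lemma independent_le_rank:
  assumes x: "\<And>i. i < k \<Longrightarrow> x i \<in> carrier L"
    and ind: "\<And>a i. (\<And>i. i < k \<Longrightarrow> a i \<in> OK) \<Longrightarrow>
       (\<And>j. j < k \<Longrightarrow> (\<Sum>i<k. a i * B (x i) (x j)) = 0) \<Longrightarrow> i < k \<Longrightarrow> a i = 0"
  shows "k \<le> lattice_rank K L"
proof -
  have ind_K: "c i = 0" if c: "\<And>i. i < k \<Longrightarrow> c i \<in> K"
    "\<And>j. j < k \<Longrightarrow> (\<Sum>i<k. c i * B (x i) (x j)) = 0" "i < k" for c i
  proof -
    obtain m :: int where m: "m \<noteq> 0" "\<forall>i<k. of_int m * c i \<in> OK"
      using ex_common_denominator[of k c] c(1) by blast
    have "(\<Sum>i<k. of_int m * c i * B (x i) (x j)) = 0" if "j < k" for j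
      using c(2)[OF that] by (simp add: mult.assoc flip: sum_distrib_left)
    then have "of_int m * c i = 0" using m(2) c(3) ind[of "\<lambda>i. of_int m * c i" i] by blast
    then show ?thesis using m(1) by simp
  qed
  define u where "u i = tens (x i) 1" for i
  have uT: "u i \<in> carrier T" if "i < k" for i using tens_T[OF x[OF that] K_1] by (simp add: u_def)
  have eval_u: "eval_T (x j) (u i) = B (x i) (x j)" if "i < k" "j < k" for i j
    using eval_T_tens[OF x[OF that(1)] K_1 x[OF that(2)]] by (simp add: u_def)
  \<comment> \<open>Equal tensors would give the relation with coefficients 1 and -1. Injectivity
    ensures that the independent set has \<open>k\<close> elements.\<close>
  have inj: "inj_on u {..<k}"
  proof (rule inj_onI, rule ccontr)
    fix i j assume ij: "i \<in> {..<k}" "j \<in> {..<k}" "u i = u j" "i \<noteq> j"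
    let ?c = "\<lambda>l. if l = i then 1 else if l = j then - 1 else (0 :: real)"
    have "(\<Sum>l<k. ?c l * B (x l) (x h)) = 0" if h: "h < k" for h
    proof -
      have "(\<Sum>l<k. ?c l * B (x l) (x h)) =
          (\<Sum>l<k. (if l = i then B (x l) (x h) else 0) + (if l = j then - B (x l) (x h) else 0))"
        using ij(4) by (intro sum.cong) auto
      also have "\<dots> = B (x i) (x h) - B (x j) (x h)" using ij by (simp add: sum.distrib)
      also have "\<dots> = 0" using eval_u[of i h] eval_u[of j h] ij h by simp
      finally show ?thesis .
    qed
    moreover have "?c l \<in> K" for l using K_0 K_1 K_of_int[of "-1"] by simp
    ultimately have "?c i = 0" using ind_K[of ?c i] ij by blast
    then show False by simp
  qed
  have "T.lin_indpt (u ` {..<k})"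
  proof
    assume "T.lin_dep (u ` {..<k})"
    then obtain A a C where A: "finite A" "A \<subseteq> u ` {..<k}" "a \<in> A \<rightarrow> K" "T.lincomb a A = \<zero>\<^bsub>T\<^esub>"
      "C \<in> A" "a C \<noteq> 0"
      by (auto simp: T.lin_dep_def)
    \<comment> \<open>The dependence may involve only part of the family, so its coefficients are
      extended by zero.\<close>
    define c where "c i = (if u i \<in> A then a (u i) else 0)" for i
    have AT: "A \<subseteq> carrier T" using A(2) uT by blast
    have "(\<Sum>i<k. c i * B (x i) (x j)) = 0" if j: "j < k" for j
    proof -
      have "(\<Sum>i<k. c i * B (x i) (x j)) = (\<Sum>i<k. (if u i \<in> A then a (u i) else 0) * eval_T (x j) (u i))"
        using j by (intro sum.cong) (auto simp: c_def eval_u)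
      also have "\<dots> = (\<Sum>D\<in>u ` {..<k}. (if D \<in> A then a D else 0) * eval_T (x j) D)"
        by (simp add: sum.reindex[OF inj])
      also have "\<dots> = (\<Sum>D\<in>A. a D * eval_T (x j) D)"
        using A(2) by (intro sum.mono_neutral_cong_right) auto
      also have "\<dots> = 0"
        using eval_T_lincomb[OF A(1) AT A(3) x[OF j]] A(4) eval_T_zero[OF x[OF j]] by simp
      finally show ?thesis .
    qed
    moreover have "c i \<in> K" for i using A(3) K_0 by (auto simp: c_def)
    moreover obtain i where "i < k" "u i = C" using A(2,5) by blast
    ultimately have "c i = 0" using ind_K[of c i] by blast
    then show False using A(5,6) \<open>u i = C\<close> by (simp add: c_def)
  qed
  moreover have "u ` {..<k} \<subseteq> carrier T" using uT by auto
  ultimately have "card (u ` {..<k}) \<le> T.dim" by (intro T.li_le_dim(2)[OF fin_dim_T])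
  then show ?thesis using card_image[OF inj] by (simp add: lattice_rank_def)
qed

end

section \<open>Unit classes\<close>

context unit_family
begin

lemma family_le_rank: "k \<le> lattice_rank K L"
proof -
  obtain t x where x: "\<And>i. i < k \<Longrightarrow> x i \<in> carrier L" "\<And>i. i < k \<Longrightarrow> height t (x i) > 0"
    and obtuse: "\<And>i j. i < k \<Longrightarrow> j < k \<Longrightarrow> i \<noteq> j \<Longrightarrow> B (x i) (x j) \<le> 0"
    using ex_obtuse_system by blast
  show ?thesis
  proof (rule independent_le_rank)
    fix a i
    assume a: "\<And>i. i < k \<Longrightarrow> a i \<in> OK" "\<And>j. j < k \<Longrightarrow> (\<Sum>i<k. a i * B (x i) (x j)) = 0" and i: "i < k"
    have "a i \<le> 0" by (rule obtuse_independent[OF x obtuse a i])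
    \<comment> \<open>The one-sided bound, applied to the negated relation, gives the other
      sign.\<close>
    moreover have "- a i \<le> 0"
      by (rule obtuse_independent[of x t "\<lambda>i. - a i", OF x obtuse _ _ i])
         (simp_all add: a OK_uminus sum_negf)
    ultimately show "a i = 0" by simp
  qed (rule x)
qed

end

context pd_lattice
begin

lemma Units_mult: "x \<in> Units (integers_of K) \<Longrightarrow> y \<in> Units (integers_of K) \<Longrightarrow> x * y \<in> Units (integers_of K)"
  by (auto simp: Units_integers_of_iff OK_mult)

lemma Units_inverse: "x \<in> Units (integers_of K) \<Longrightarrow> inverse x \<in> Units (integers_of K)"
  by (auto simp: Units_integers_of_iff)

text \<open>Any member \<open>d\<close> differs from the given representative by the square of a
  unit, which is invertible, so \<open>d\<close> represents the class equally well.\<close>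

lemma unit_class_eq:
  assumes C: "C \<in> carrier (unit_class_group K)" and d: "d \<in> C"
  shows "d \<in> Units (integers_of K)" "C = {e\<^sup>2 * d |e. e \<in> Units (integers_of K)}"
proof -
  obtain u where u: "u \<in> Units (integers_of K)" "C = {e\<^sup>2 * u |e. e \<in> Units (integers_of K)}"
    using C by (auto simp: unit_class_group_def FactGroup_def RCOSETS_def r_coset_def units_of_def
        totally_positive_units_def unit_squares_def)
  then obtain a where a: "a \<in> Units (integers_of K)" "d = a\<^sup>2 * u" using d by auto
  show "d \<in> Units (integers_of K)" using a u(1) Units_mult by (simp add: power2_eq_square)
  have "a \<noteq> 0" using a(1) by (simp add: Units_integers_of_iff)
  then have "e\<^sup>2 * u = (e * inverse a)\<^sup>2 * d" "e\<^sup>2 * d = (e * a)\<^sup>2 * u" for e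
    using a(2) by (simp_all add: power_mult_distrib power_inverse)
  then show "C = {e\<^sup>2 * d |e. e \<in> Units (integers_of K)}"
    unfolding u(2) using Units_mult[OF _ a(1)] Units_mult[OF _ Units_inverse[OF a(1)]] by blast
qed

text \<open>One represented value per class gives a \<open>unit_family\<close>. Finite subsets are
  treated because finiteness of the whole set is not yet known.\<close>

lemma card_classes_le_rank:
  assumes A: "A \<subseteq> represented_classes K L Q" "finite A"
  shows "card A \<le> lattice_rank K L"
proof -
  have AC: "C \<in> carrier (unit_class_group K)" if "C \<in> A" for C
    using A(1) that by (auto simp: represented_classes_def)
  have "\<forall>C. \<exists>v. C \<in> A \<longrightarrow> v \<in> carrier L \<and> Q v \<in> C"
    using A(1) by (auto simp: represented_classes_def represents_def)
  then obtain f where f: "\<And>C. C \<in> A \<Longrightarrow> f C \<in> carrier L" "\<And>C. C \<in> A \<Longrightarrow> Q (f C) \<in> C"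
    by metis
  obtain h where h: "bij_betw h {..<card A} A"
    using ex_bij_betw_nat_finite[OF A(2)] by (auto simp: atLeast0LessThan)
  have hA: "h i \<in> A" if "i < card A" for i using h that by (auto simp: bij_betw_def)
  have "unit_family K L Q (\<lambda>i. f (h i)) (card A)"
  proof
    fix i assume i: "i < card A"
    show "f (h i) \<in> carrier L" using f(1) hA[OF i] .
    show "Q (f (h i)) \<in> Units (integers_of K)"
      using unit_class_eq(1)[OF AC f(2)] hA[OF i] by blast
    fix j e assume j: "j < card A" "i \<noteq> j" and e: "e \<in> Units (integers_of K)"
    note ci = unit_class_eq(2)[OF AC[OF hA[OF i]]] and cj = unit_class_eq(2)[OF AC[OF hA[OF j(1)]]]
    show "Q (f (h i)) \<noteq> e\<^sup>2 * Q (f (h j))"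
    proof
      assume "Q (f (h i)) = e\<^sup>2 * Q (f (h j))"
      then have "Q (f (h i)) \<in> h j" using cj[OF f(2)[OF hA[OF j(1)]]] e by blast
      then have "h i = h j" using ci[OF f(2)[OF hA[OF i]]] cj by blast
      then show False using h i j by (auto simp: bij_betw_def inj_on_def)
    qed
  qed
  then show ?thesis by (rule unit_family.family_le_rank)
qed

end

theorem theorem3p2:
  fixes K :: "real set"
    and L :: "(real, 'v, 'm) module_scheme"
    and Q :: "'v \<Rightarrow> real"
    and n :: nat
  assumes "totally_real_field K"
    and "quadratic_lattice K L Q"
    and "positive_definite K L Q"
    and "lattice_rank K L = n"
    and "n \<ge> 2"
  shows "finite (represented_classes K L Q) \<and>
         card (represented_classes K L Q) \<le> 2 * n - 2 \<and>
         ({gamma_of K * x\<^sup>2 |x. x \<in> K - {0}} \<inter> totally_positive_units K = {} \<longrightarrow>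
           card (represented_classes K L Q) \<le> n)"
proof -
  interpret pd_lattice K L Q
    by unfold_locales (use assms in auto)
  \<comment> \<open>A uniform bound on the finite subsets also yields finiteness of the whole
    set.\<close>
  have "finite (represented_classes K L Q) \<and> card (represented_classes K L Q) \<le> n"
    by (rule finite_if_finite_subsets_card_bdd) (use card_classes_le_rank assms(4) in blast)
  then show ?thesis using assms(5) by auto
qed

end
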